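(* There exist positive constants $c_3,c_2$ such that for every positive integer $n$, $$R(n)\le\tfrac12-c_3n^{-5/2},\qquad R^p(n)\le\tfrac{2}{\pi}-c_2n^{-4}.$$ Consequently there is a constant $c>0$ such that for every $r\in[0,\tfrac12)$, $$\gamma(\omega_r)\ge N(r)> c\left(\tfrac12-r\right)^{-2/5}.$$
   Context: Qubit POVM: finite family $\{\Pi_i\}_{i=1}^n$ of positive semidefinite operators summing to $\mathbb{I}$; it simulates $\{M_{a|x}\}$ if $M_{a|x}=\sum_i p(a|x,i)\Pi_i$ with $p(a|x,i)\ge0$, $\sum_a p(a|x,i)=1$. $\mathcal{P}_r$: the two-outcome POVMs $\{\tfrac12(\mathbb{I}\pm r\hat n\cdot\vec\sigma)\}$ over all unit $\hat n\in\mathbb{R}^3$; $\mathcal{P}^p_r$: subfamily with $\hat n=(n_x,0,n_z)$. $R(n)$ (resp. $R^p(n)$): supremum of $r$ such that some $n$-outcome qubit POVM simulates $\mathcal{P}_r$ (resp. $\mathcal{P}^p_r$). $N(r)$: smallest $n$ such that some $n$-outcome qubit POVM simulates $\mathcal{P}_r$ ($+\infty$ if none). $\omega_r=r|\Psi^-\rangle\langle\Psi^-|+(1-r)\mathbb{I}\otimes\mathbb{I}/4$. The assemblage generated from $\rho_{AB}$ by POVMs $\{M_{a|x}\}$ on $A$ is $\sigma_{a|x}=\mathrm{Tr}_A[(M_{a|x}\otimes\mathbb{I})\rho_{AB}]$; an LHS model of size $n$ is a distribution $p(i)$ on $\{1,\dots,n\}$, states $\rho_i$ on $B$, and $p(a|x,i)$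 with $\sigma_{a|x}=\sum_{i=1}^n p(a|x,i)p(i)\rho_i$. $\gamma(\rho_{AB})$: smallest $n$ such that every assemblage generated from $\rho_{AB}$ by any family of POVMs on $A$ admits an LHS model of size $n$. *)

theory Defs
  imports "HOL-Analysis.Analysis" "HOL-Library.Extended_Nat"
begin

text \<open>Qubit operators are 2x2 complex matrices; two-qubit operators are indexed by 2 x 2
  (first component = system A, second = system B).\<close>

type_synonym qop = "complex^2^2"
type_synonym qqop = "complex^(2\<times>2)^(2\<times>2)"

definition psd :: "complex^'n^'n \<Rightarrow> bool" where
  "psd A \<longleftrightarrow> (\<forall>v::complex^'n. let z = (\<Sum>i\<in>UNIV. cnj (v$i) * (A *v v)$i)
                                  in Im z = 0 \<and> 0 \<le> Re z)"

definition ctrace :: "complex^'n^'n \<Rightarrow> complex" where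
  "ctrace A = (\<Sum>i\<in>UNIV. A$i$i)"

definition is_state :: "complex^'n^'n \<Rightarrow> bool" where
  "is_state \<rho> \<longleftrightarrow> psd \<rho> \<and> ctrace \<rho> = 1"

definition povm :: "qop list \<Rightarrow> bool" where
  "povm M \<longleftrightarrow> (\<forall>a<length M. psd (M!a)) \<and> (\<Sum>a<length M. M!a) = mat 1"

text \<open>A family of POVMs {M_{a|x}} is represented by the set of its members.
  The POVM Pm simulates the family F.\<close>
definition simulates :: "qop list \<Rightarrow> qop list set \<Rightarrow> bool" where
  "simulates Pm F \<longleftrightarrow> (\<exists>p :: qop list \<Rightarrow> nat \<Rightarrow> nat \<Rightarrow> real.
     \<forall>M\<in>F. (\<forall>a<length M. M!a = (\<Sum>i<length Pm. p M a i *\<^sub>R (Pm!i)))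
        \<and> (\<forall>a<length M. \<forall>i<length Pm. 0 \<le> p M a i)
        \<and> (\<forall>i<length Pm. (\<Sum>a<length M. p M a i) = 1))"

definition sigma_x :: qop where
  "sigma_x = (\<chi> i j. if i = j then 0 else 1)"
definition sigma_y :: qop where
  "sigma_y = (\<chi> i j. if i = j then 0 else if i = 0 then - \<i> else \<i>)"
definition sigma_z :: qop where
  "sigma_z = (\<chi> i j. if i = j then (if i = 0 then 1 else -1) else 0)"

definition ndotsigma :: "real^3 \<Rightarrow> qop" where
  "ndotsigma n = (n$1) *\<^sub>R sigma_x + (n$2) *\<^sub>R sigma_y + (n$3) *\<^sub>R sigma_z"

definition noisy_meas :: "real \<Rightarrow> real^3 \<Rightarrow> qop list" where
  "noisy_meas r n = [(1/2) *\<^sub>R (mat 1 + r *\<^sub>R ndotsigma n), (1/2) *\<^sub>R (mat 1 - r *\<^sub>R ndotsigma n)]"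

definition Pfam :: "real \<Rightarrow> qop list set" where
  "Pfam r = {noisy_meas r n | n. norm n = 1}"

definition Pfam_p :: "real \<Rightarrow> qop list set" where
  "Pfam_p r = {noisy_meas r n | n. norm n = 1 \<and> n$2 = 0}"

definition Rn :: "nat \<Rightarrow> real" where
  "Rn n = Sup {r. 0 \<le> r \<and> (\<exists>Pm. povm Pm \<and> length Pm = n \<and> simulates Pm (Pfam r))}"

definition Rpn :: "nat \<Rightarrow> real" where
  "Rpn n = Sup {r. 0 \<le> r \<and> (\<exists>Pm. povm Pm \<and> length Pm = n \<and> simulates Pm (Pfam_p r))}"

text \<open>N(r); the infimum of the empty set of enat is \<infinity>.\<close>
definition Nr :: "real \<Rightarrow> enat" where
  "Nr r = Inf {enat n | n. \<exists>Pm. povm Pm \<and> length Pm = n \<and> simulates Pm (Pfam r)}"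

text \<open>Assemblage element Tr_A[(M \<otimes> I) \<rho>_AB].\<close>
definition assemb :: "qqop \<Rightarrow> qop \<Rightarrow> qop" where
  "assemb \<rho> M = (\<chi> b b'. \<Sum>a\<in>UNIV. \<Sum>a'\<in>UNIV. M$a'$a * \<rho>$(a,b)$(a',b'))"

definition has_LHS :: "nat \<Rightarrow> qqop \<Rightarrow> qop list set \<Rightarrow> bool" where
  "has_LHS n \<rho> F \<longleftrightarrow> (\<exists>(p :: nat \<Rightarrow> real) (\<sigma> :: nat \<Rightarrow> qop) (q :: qop list \<Rightarrow> nat \<Rightarrow> nat \<Rightarrow> real).
     (\<forall>i<n. 0 \<le> p i \<and> is_state (\<sigma> i)) \<and> (\<Sum>i<n. p i) = 1 \<and>
     (\<forall>M\<in>F. (\<forall>a<length M. \<forall>i<n. 0 \<le> q M a i)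
        \<and> (\<forall>i<n. (\<Sum>a<length M. q M a i) = 1)
        \<and> (\<forall>a<length M. assemb \<rho> (M!a) = (\<Sum>i<n. (q M a i * p i) *\<^sub>R \<sigma> i))))"

definition gamma :: "qqop \<Rightarrow> enat" where
  "gamma \<rho> = Inf {enat n | n. \<forall>F. (\<forall>M\<in>F. povm M) \<longrightarrow> has_LHS n \<rho> F}"

definition psi_minus :: "complex^(2\<times>2)" where
  "psi_minus = (\<chi> k. if k = (0,1) then complex_of_real (1 / sqrt 2)
                     else if k = (1,0) then - complex_of_real (1 / sqrt 2) else 0)"

definition werner :: "real \<Rightarrow> qqop" where
  "werner r = (\<chi> j k. complex_of_real r * psi_minus$j * cnj (psi_minus$k)
                       + (if j = k then complex_of_real ((1 - r) / 4) else 0))"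

end

theory Submission
  imports Defs
begin

text \<open>
  Let \<open>u\<^sub>i\<close> be the unnormalised Bloch vectors of the simulating POVM, so \<open>\<Sum>\<bar>u\<^sub>i\<bar> \<le> 1\<close>. Simulation of
  radius \<open>r\<close> forces \<open>h(x) = \<Sum>\<bar>u\<^sub>i \<bullet> x\<bar> \<ge> r \<bar>x\<bar>\<close> for all \<open>x\<close>. By rotation invariance the integral of
  \<open>h\<close> over the unit ball is at most \<open>\<kappa>\<close> times that of \<open>\<bar>x\<bar>\<close>, with \<open>\<kappa> = 1/2\<close> in space and \<open>\<kappa> = 2/\<pi>\<close> in
  the plane. The bound cannot be tight: outside the slabs \<open>\<bar>u\<^sub>i \<bullet> x\<bar> < s \<bar>u\<^sub>i\<bar>\<close> and for \<open>e\<close>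
  orthogonal to \<open>x\<close> with \<open>\<bar>e\<bar> = s\<close>, the function \<open>h\<close> is affine between \<open>x - e\<close> and \<open>x + e\<close>, whence
  \<open>h(x) \<ge> r sqrt(\<bar>x\<bar>^2 + s^2) \<ge> r (\<bar>x\<bar> + s^2/3)\<close>. For \<open>s\<close> a small multiple of \<open>1/n\<close> the \<open>n\<close> slabs cover only a
  fixed fraction of the ball, which gives a deficit of order \<open>n^(-2)\<close>, better than both claimed rates.

  An LHS model of the Werner state for the projective measurements yields a simulating POVM with
  effects \<open>2 p\<^sub>i \<rho>\<^sub>i\<close>.
\<close>

section \<open>Integrals over the unit ball\<close>

lemma borel_measurable_linear:
  fixes f :: "'a::euclidean_space \<Rightarrow> 'b::euclidean_space"
  assumes "linear f"
  shows "f \<in> borel_measurable borel"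
  using assms by (intro borel_measurable_continuous_onI linear_continuous_on)
    (simp add: linear_conv_bounded_linear)

text \<open>Orthogonal maps preserve the volume of boxes, and a Borel measure with the right values
  on boxes is \<open>lborel\<close>.\<close>

lemma lborel_distr_orthogonal:
  fixes f :: "real^'n::{finite,wellorder} \<Rightarrow> real^'n::_"
  assumes f: "orthogonal_transformation f"
  shows "distr lborel borel f = lborel"
proof (rule lborel_eqI[symmetric])
  have lin: "linear f" and bij: "bij f"
    using f by (simp_all add: orthogonal_transformation_def orthogonal_transformation_bij)
  have g: "orthogonal_transformation (inv f)"
    using f by (rule orthogonal_transformation_inv)
  have meas: "f \<in> borel_measurable lborel"
    using borel_measurable_linear[OF lin] by simp
  fix l u :: "real^'n::_"
  assume le: "\<And>b. b \<in> Basis \<Longrightarrow> l \<bullet> b \<le> u \<bullet> b"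
  have B: "box l u \<in> lmeasurable" by simp
  have vi: "f -` box l u = inv f ` box l u"
    using bij by (simp add: bij_vimage_eq_inv_image)
  have lm: "f -` box l u \<in> lmeasurable"
    unfolding vi by (rule measurable_orthogonal_image[OF g B])
  have m: "measure lebesgue (f -` box l u) = measure lebesgue (box l u)"
    unfolding vi by (rule measure_orthogonal_image[OF g B])
  \<comment> \<open>The volume formula above is for Lebesgue measure; on a Borel set it agrees with
    \<open>lborel\<close>.\<close>
  have sb: "f -` box l u \<in> sets lborel"
    using measurable_sets[OF meas, of "box l u"] by simp
  have "emeasure (distr lborel borel f) (box l u) = emeasure lborel (f -` box l u)"
    using meas by (subst emeasure_distr) simp_all
  also have "\<dots> = emeasure lebesgue (f -` box l u)"
    using sb by simp
  also have "\<dots> = emeasure lebesgue (box l u)"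
    using emeasure_eq_measure2[OF lm] emeasure_eq_measure2[OF B] m by simp
  also have "\<dots> = emeasure lborel (box l u)" by simp
  also have "\<dots> = (\<Prod>b\<in>Basis. (u - l) \<bullet> b)"
    using le by (simp add: emeasure_lborel_box)
  finally show "emeasure (distr lborel borel f) (box l u) = (\<Prod>b\<in>Basis. (u - l) \<bullet> b)" .
qed simp

lemma borel_measurable_indicator_cball_mult:
  fixes g :: "'a::euclidean_space \<Rightarrow> ennreal"
  assumes "g \<in> borel_measurable borel"
  shows "(\<lambda>x. indicator (cball a r) x * g x) \<in> borel_measurable borel"
  by (intro borel_measurable_times_ennreal borel_measurable_indicator assms) simp

text \<open>Some rotation takes the vector of length \<open>norm u\<close> on axis \<open>k\<close>
  to \<open>u\<close>, and it preserves both the ball and the measure. With \<open>\<phi>\<close> an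
  indicator this measures slabs, with \<open>\<phi>\<close> the absolute value it integrates the
  generators of a zonotope.\<close>

lemma nn_integral_cball_inner:
  fixes u :: "real^'n::{finite,wellorder}" and k :: 'n and \<phi> :: "real \<Rightarrow> ennreal"
  assumes [measurable]: "\<phi> \<in> borel_measurable borel"
  shows "(\<integral>\<^sup>+x. indicator (cball 0 1) x * \<phi> (u \<bullet> x) \<partial>lborel) =
         (\<integral>\<^sup>+x. indicator (cball 0 1) x * \<phi> (norm u * x $ k) \<partial>lborel)"
proof -
  have "norm (norm u *\<^sub>R axis k (1::real)) = norm u" by (simp add: norm_axis_1)
  then obtain f :: "real^'n::_ \<Rightarrow> real^'n::_" where f: "orthogonal_transformation f"
    and fu: "f (norm u *\<^sub>R axis k 1) = u"
    using orthogonal_transformation_exists by blast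
  have [measurable]: "f \<in> borel_measurable borel"
    using f by (simp add: orthogonal_transformation_def borel_measurable_linear)
  have "(\<lambda>x. \<phi> (u \<bullet> x)) \<in> borel_measurable borel" by measurable
  hence meas: "(\<lambda>x. indicator (cball 0 1) x * \<phi> (u \<bullet> x)) \<in> borel_measurable borel"
    by (rule borel_measurable_indicator_cball_mult)
  have inner: "u \<bullet> f x = norm u * x $ k" for x
  proof -
    have "u \<bullet> f x = f (norm u *\<^sub>R axis k 1) \<bullet> f x" by (simp add: fu)
    also have "\<dots> = (norm u *\<^sub>R axis k 1) \<bullet> x"
      using f unfolding orthogonal_transformation_def by blast
    finally show ?thesis by (simp add: inner_axis')
  qed
  have "(\<integral>\<^sup>+x. indicator (cball 0 1) x * \<phi> (u \<bullet> x) \<partial>lborel) =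
        (\<integral>\<^sup>+x. indicator (cball 0 1) x * \<phi> (u \<bullet> x) \<partial>distr lborel borel f)"
    by (simp add: lborel_distr_orthogonal[OF f])
  also have "\<dots> = (\<integral>\<^sup>+x. indicator (cball 0 1) (f x) * \<phi> (u \<bullet> f x) \<partial>lborel)"
    using meas by (subst nn_integral_distr) simp_all
  also have "\<dots> = (\<integral>\<^sup>+x. indicator (cball 0 1) x * \<phi> (norm u * x $ k) \<partial>lborel)"
    using f by (intro nn_integral_cong)
      (simp add: inner indicator_def orthogonal_transformation_norm)
  finally show ?thesis .
qed

text \<open>After rotation to a coordinate axis, the slab inside the ball fits in a box of width
  \<open>2 * s\<close> in one direction and width 2 in all others. For \<open>u = 0\<close> the
  strict inequality makes the set empty.\<close>

lemma emeasure_cball_slab_le: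
  fixes u :: "real^'n::{finite,wellorder}"
  assumes "0 \<le> s"
  shows "emeasure lborel (cball 0 1 \<inter> {x. \<bar>u \<bullet> x\<bar> < s * norm u}) \<le> ennreal (2 ^ CARD('n) * s)"
proof (cases "u = 0")
  case False
  \<comment> \<open>Any coordinate will do.\<close>
  define k :: "'n::{finite,wellorder}" where "k = undefined"
  define b :: "real^'n::_" where "b = (\<chi> i. if i = k then s else 1)"
  have b: "b \<in> cbox (-b) b" using assms by (simp add: b_def mem_box_cart)
  have "emeasure lborel (cball 0 1 \<inter> {x. \<bar>u \<bullet> x\<bar> < s * norm u}) =
     (\<integral>\<^sup>+x. indicator (cball 0 1) x * indicator {-s * norm u<..<s * norm u} (u \<bullet> x) \<partial>lborel)"
    by (subst nn_integral_indicator[symmetric], measurable)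
      (intro nn_integral_cong, auto simp: indicator_def abs_less_iff)
  also have "\<dots> = (\<integral>\<^sup>+x. indicator (cball 0 1) x *
      indicator {-s * norm u<..<s * norm u} (norm u * x $ k) \<partial>lborel)"
    by (rule nn_integral_cball_inner) simp
  also have "\<dots> \<le> (\<integral>\<^sup>+x. indicator (cbox (-b) b) x \<partial>lborel)"
  proof (intro nn_integral_mono)
    fix x :: "real^'n::_"
    have "x \<in> cbox (-b) b" if "norm x \<le> 1" "-s * norm u < norm u * x $ k" "norm u * x $ k < s * norm u"
    proof -
      have "\<bar>norm u * x $ k\<bar> < norm u * s" using that by (simp add: abs_less_iff mult.commute)
      hence "\<bar>x $ k\<bar> < s" using False by (simp add: abs_mult)
      hence "- s \<le> x $ k" "x $ k \<le> s" by linarith+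
      moreover have "- 1 \<le> x $ i" "x $ i \<le> 1" for i 
        using component_le_norm_cart[of x i] that(1) by linarith+
      ultimately show ?thesis
        by (auto simp: mem_box_cart b_def)
    qed
    thus "indicator (cball 0 1) x * indicator {-s * norm u<..<s * norm u} (norm u * x $ k)
       \<le> (indicator (cbox (-b) b) x :: ennreal)"
      by (auto simp: indicator_def)
  qed
  also have "\<dots> = emeasure lborel (cbox (-b) b)" by simp
  also have "\<dots> = ennreal (measure lborel (cbox (-b) b))"
    by (rule emeasure_eq_ennreal_measure) (simp add: emeasure_lborel_cbox_eq)
  also have "measure lborel (cbox (-b) b) = (\<Prod>i\<in>UNIV. 2 * (if i = k then s else 1))"
    using b by (subst content_cbox_cart) (auto intro!: prod.cong simp: b_def)
  also have "\<dots> = 2 ^ CARD('n) * s"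
    by (subst prod.distrib) simp
  finally show ?thesis .
qed simp

text \<open>Layer-cake formula: \<open>norm x\<close> is the length of \<open>{0..<norm x}\<close>.
  After exchanging the integrals, the inner one is the volume of the shell between radii
  \<open>t\<close> and 1, which is then integrated by its antiderivative.\<close>

lemma nn_integral_cball_norm:
  "(\<integral>\<^sup>+x. indicator (cball 0 1 :: 'a::euclidean_space set) x * ennreal (norm x) \<partial>lborel) =
    ennreal (DIM('a) / (DIM('a) + 1) * unit_ball_vol DIM('a))"
proof -
  define V where "V = unit_ball_vol (real DIM('a))"
  have V: "0 \<le> V" by (simp add: V_def)
  have "(\<integral>\<^sup>+x. indicator (cball 0 1 :: 'a set) x * ennreal (norm x) \<partial>lborel) =
     (\<integral>\<^sup>+x. \<integral>\<^sup>+t. indicator (cball 0 1 :: 'a set) x * indicator {0..<norm x} t \<partial>lborel \<partial>lborel)"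
    by (rule nn_integral_cong, subst nn_integral_cmult) simp_all
  also have "\<dots> = (\<integral>\<^sup>+t. \<integral>\<^sup>+x. indicator (cball 0 1 :: 'a set) x * indicator {0..<norm x} (t::real) \<partial>lborel \<partial>lborel)"
    by (rule lborel_pair.Fubini') (simp add: indicator_def, measurable)
  also have "\<dots> = (\<integral>\<^sup>+t. indicator {0..1} t * ennreal (V * (1 - t ^ DIM('a))) \<partial>lborel)"
  proof (intro nn_integral_cong)
    fix t :: real
    show "(\<integral>\<^sup>+x. indicator (cball 0 1 :: 'a set) x * indicator {0..<norm x} (t::real) \<partial>lborel) =
      indicator {0..1} t * ennreal (V * (1 - t ^ DIM('a)))"
    proof (cases "t \<in> {0..1}")
      case True
      hence t: "0 \<le> t" "t \<le> 1" by auto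
      have "(\<integral>\<^sup>+x. indicator (cball 0 1 :: 'a set) x * indicator {0..<norm x} (t::real) \<partial>lborel) =
        (\<integral>\<^sup>+(x::'a). indicator (cball 0 1 - cball 0 t) x \<partial>lborel)"
        using t by (intro nn_integral_cong) (auto simp: indicator_def)
      also have "\<dots> = emeasure lborel (cball 0 1 :: 'a set) - emeasure lborel (cball 0 t :: 'a set)"
        using t by (simp, subst emeasure_Diff) (auto simp: emeasure_cball)
      also have "\<dots> = ennreal (V - V * t ^ DIM('a))"
        using t V by (simp add: emeasure_cball V_def ennreal_minus)
      finally show ?thesis using True by (simp add: right_diff_distrib)
    next
      case False
      hence "(\<integral>\<^sup>+x. indicator (cball 0 1 :: 'a set) x * indicator {0..<norm x} (t::real) \<partial>lborel) = (\<integral>\<^sup>+x. 0 \<partial>(lborel :: 'a measure))"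
        by (intro nn_integral_cong) (auto simp: indicator_def)
      thus ?thesis using False by simp
    qed
  qed
  also have "\<dots> = (\<integral>\<^sup>+t. ennreal (V * (1 - t ^ DIM('a))) * indicator {0..1} t \<partial>lborel)"
    by (simp add: mult.commute)
  also have "\<dots> = ennreal (V * (1 - 1 ^ Suc DIM('a) / Suc DIM('a)) - V * (0 - 0 ^ Suc DIM('a) / Suc DIM('a)))"
  proof (rule nn_integral_FTC_Icc[where F = "\<lambda>t. V * (t - t ^ Suc DIM('a) / Suc DIM('a))"])
    fix t :: real assume "t \<in> {0..1}"
    hence "0 \<le> t" "t \<le> 1" by auto
    show "((\<lambda>t. V * (t - t ^ Suc DIM('a) / Suc DIM('a))) has_real_derivative V * (1 - t ^ DIM('a)))
       (at t)"
      using DERIV_cmult[OF DERIV_diff[OF DERIV_ident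
          DERIV_cdivide[OF DERIV_pow[of "Suc DIM('a)" t], of "Suc DIM('a)"]], of V] by simp
    show "0 \<le> V * (1 - t ^ DIM('a))"
      using V \<open>0 \<le> t\<close> \<open>t \<le> 1\<close> by (simp add: power_le_one)
  qed auto
  also have "V * (1 - 1 ^ Suc DIM('a) / Suc DIM('a)) - V * (0 - 0 ^ Suc DIM('a) / Suc DIM('a)) =
     DIM('a) / (DIM('a) + 1) * V"
    by (simp add: field_simps)
  finally show ?thesis by (simp add: V_def)
qed

section \<open>The absolute value of a coordinate, integrated over the disc and the ball\<close>

lemma emeasure_lborel_box_cart:
  fixes l u :: "real^'n"
  assumes "\<And>i. l $ i \<le> u $ i"
  shows "emeasure lborel (box l u) = ennreal (\<Prod>i\<in>UNIV. u $ i - l $ i)"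
proof -
  have le: "l \<bullet> b \<le> u \<bullet> b" if "b \<in> Basis" for b
    using that assms by (auto simp: Basis_vec_def inner_axis)
  have "emeasure lborel (box l u) = emeasure lborel (cbox l u)"
    using le by (simp add: emeasure_lborel_box emeasure_lborel_cbox)
  also have "\<dots> = ennreal (measure lborel (cbox l u))"
    by (rule emeasure_eq_ennreal_measure) (simp add: emeasure_lborel_cbox_eq)
  also have "measure lborel (cbox l u) = (\<Prod>i\<in>UNIV. u $ i - l $ i)"
    using assms by (intro content_cbox_cart) (auto simp: interval_ne_empty_cart)
  finally show ?thesis .
qed

lemma box_Pair_eq: "box (a, b) (c, d) = box a c \<times> box b d"
  for a c :: "'a::euclidean_space" and b d :: "'b::euclidean_space"
  by (auto simp: box_def Basis_prod_def ball_Un)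

lemma emeasure_lborel_Times:
  assumes "A \<in> sets borel" "B \<in> sets borel"
  shows "emeasure lborel (A \<times> B) = emeasure lborel A * emeasure lborel B"
  using assms by (simp add: lborel_prod[symmetric] lborel.emeasure_pair_measure_Times)

text \<open>Transports integrals from vectors to pairs, where the first coordinate can be split off
  by Fubini. It holds because boxes correspond to boxes of the same volume.\<close>

lemma lborel_distr_vec2:
  "distr lborel borel (\<lambda>x::real^2. (x $ 1, x $ 2)) = (lborel :: (real \<times> real) measure)"
proof (rule lborel_eqI[symmetric])
  fix l u :: "real \<times> real"
  assume le: "\<And>b. b \<in> Basis \<Longrightarrow> l \<bullet> b \<le> u \<bullet> b"
  obtain l1 l2 u1 u2 where lu: "l = (l1, l2)" "u = (u1, u2)" by (cases l, cases u)
  have le': "l1 \<le> u1" "l2 \<le> u2" using le[of "(1, 0)"] le[of "(0, 1)"] lu by (auto simp: Basis_prod_def)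
  have vi: "(\<lambda>x::real^2. (x $ 1, x $ 2)) -` box l u = box (vector [l1, l2]) (vector [u1, u2])"
    by (auto simp: lu box_Pair_eq mem_box_cart forall_2)
  have "emeasure (distr lborel borel (\<lambda>x::real^2. (x $ 1, x $ 2))) (box l u) =
     emeasure lborel (box (vector [l1, l2]) (vector [u1, u2]) :: (real^2) set)"
    by (subst emeasure_distr) (simp_all add: vi)
  also have "\<dots> = ennreal ((u1 - l1) * (u2 - l2))"
  proof (subst emeasure_lborel_box_cart)
    have "\<forall>i. (vector [l1, l2] :: real^2) $ i \<le> vector [u1, u2] $ i"
      using le' by (simp add: forall_2)
    thus "(vector [l1, l2] :: real^2) $ i \<le> vector [u1, u2] $ i" for i by blast
  qed (simp add: UNIV_2)
  also have "\<dots> = emeasure lborel (box l u)"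
    using le' by (simp add: lu box_Pair_eq emeasure_lborel_Times ennreal_mult)
  also have "\<dots> = (\<Prod>b\<in>Basis. (u - l) \<bullet> b)"
    using le by (simp add: emeasure_lborel_box)
  finally show "emeasure (distr lborel borel (\<lambda>x::real^2. (x $ 1, x $ 2))) (box l u) =
      (\<Prod>b\<in>Basis. (u - l) \<bullet> b)" .
qed simp

text \<open>The triple is nested to the right, so it is a product of the first coordinate with a
  plane, the form in which the ball is sliced below.\<close>

lemma lborel_distr_vec3:
  "distr lborel borel (\<lambda>x::real^3. (x $ 1, x $ 2, x $ 3)) = (lborel :: (real \<times> real \<times> real) measure)"
proof (rule lborel_eqI[symmetric])
  fix l u :: "real \<times> real \<times> real"
  assume le: "\<And>b. b \<in> Basis \<Longrightarrow> l \<bullet> b \<le> u \<bullet> b"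
  obtain l1 l2 l3 u1 u2 u3 where lu: "l = (l1, l2, l3)" "u = (u1, u2, u3)"
    by (cases l rule: prod_cases3, cases u rule: prod_cases3) auto
  have le': "l1 \<le> u1" "l2 \<le> u2" "l3 \<le> u3"
  proof -
    have "\<forall>b\<in>Basis. l \<bullet> b \<le> u \<bullet> b" using le by blast
    thus "l1 \<le> u1" "l2 \<le> u2" "l3 \<le> u3"
      by (simp_all add: lu Basis_prod_def ball_Un)
  qed
  have vi: "(\<lambda>x::real^3. (x $ 1, x $ 2, x $ 3)) -` box l u = box (vector [l1, l2, l3]) (vector [u1, u2, u3])"
    by (auto simp: lu box_Pair_eq mem_box_cart forall_3)
  have "emeasure (distr lborel borel (\<lambda>x::real^3. (x $ 1, x $ 2, x $ 3))) (box l u) =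
     emeasure lborel (box (vector [l1, l2, l3]) (vector [u1, u2, u3]) :: (real^3) set)"
    by (subst emeasure_distr) (simp_all add: vi)
  also have "\<dots> = ennreal ((u1 - l1) * ((u2 - l2) * (u3 - l3)))"
  proof -
    have h: "(vector [l1, l2, l3] :: real^3) $ i \<le> (vector [u1, u2, u3] :: real^3) $ i" for i
      using exhaust_3[of i] le' by (elim disjE) simp_all
    show ?thesis
      unfolding emeasure_lborel_box_cart[OF h] UNIV_3 by simp
  qed
  also have "\<dots> = emeasure lborel (box l u)"
    using le' by (simp add: lu box_Pair_eq emeasure_lborel_Times borel_open open_Times ennreal_mult)
  also have "\<dots> = (\<Prod>b\<in>Basis. (u - l) \<bullet> b)"
    using le by (simp add: emeasure_lborel_box)
  finally show "emeasure (distr lborel borel (\<lambda>x::real^3. (x $ 1, x $ 2, x $ 3))) (box l u) =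
      (\<Prod>b\<in>Basis. (u - l) \<bullet> b)" .
qed simp

lemma has_integral_abs_mult_sqrt_power:
  "((\<lambda>x. \<bar>x\<bar> * sqrt (1 - x\<^sup>2) ^ k) has_integral 2 / (k + 2)) {-1..1::real}"
proof -
  define F where "F x = sqrt (1 - x\<^sup>2) ^ (k + 2) / (k + 2)" for x :: real
  have cont: "continuous_on S F" for S
    unfolding F_def by (intro continuous_intros) auto
  have deriv: "(F has_real_derivative - x * sqrt (1 - x\<^sup>2) ^ k) (at x)" if "-1 < x" "x < 1" for x
  proof -
    have "x\<^sup>2 < 1" using that by (simp add: abs_square_less_1 abs_less_iff)
    hence p: "0 < 1 - x\<^sup>2" by simp
    have "((\<lambda>x. sqrt (1 - x\<^sup>2)) has_real_derivative - x / sqrt (1 - x\<^sup>2)) (at x)"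
      using p by (auto intro!: derivative_eq_intros simp: field_simps)
    note DERIV_cdivide[OF DERIV_power[OF this, of "k + 2"], of "k + 2"]
    moreover have "real (k + 2) * (- x / sqrt (1 - x\<^sup>2) * sqrt (1 - x\<^sup>2) ^ (k + 2 - Suc 0)) / real (k + 2) =
        - x * sqrt (1 - x\<^sup>2) ^ k"
      using p by (subst nonzero_mult_div_cancel_left) simp_all
    ultimately show ?thesis unfolding F_def by (rule DERIV_cong)
  qed
  \<comment> \<open>The sign of \<open>x\<close> decides between \<open>F\<close> and
    \<open>- F\<close> as antiderivative. The square root is not differentiable at the endpoints 1
    and -1, hence the version of the fundamental theorem with derivatives in the interior only. Each
    half contributes \<open>F 0 = 1 / (k + 2)\<close>.\<close>
  have right: "((\<lambda>x. \<bar>x\<bar> * sqrt (1 - x\<^sup>2) ^ k) has_integral (- F 1) - (- F 0)) {0..1}"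
  proof (rule fundamental_theorem_of_calculus_interior)
    show "continuous_on {0..1} (\<lambda>x. - F x)" by (intro continuous_intros cont)
    fix x :: real assume "x \<in> {0<..<1}"
    thus "((\<lambda>x. - F x) has_vector_derivative \<bar>x\<bar> * sqrt (1 - x\<^sup>2) ^ k) (at x)"
      unfolding has_real_derivative_iff_has_vector_derivative[symmetric]
      using DERIV_minus[OF deriv[of x]] by simp
  qed simp
  have left: "((\<lambda>x. \<bar>x\<bar> * sqrt (1 - x\<^sup>2) ^ k) has_integral F 0 - F (-1)) {-1..0}"
  proof (rule fundamental_theorem_of_calculus_interior)
    fix x :: real assume "x \<in> {-1<..<0}"
    thus "(F has_vector_derivative \<bar>x\<bar> * sqrt (1 - x\<^sup>2) ^ k) (at x)"
      unfolding has_real_derivative_iff_has_vector_derivative[symmetric]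
      using deriv[of x] by simp
  qed (auto intro: cont)
  have "((\<lambda>x. \<bar>x\<bar> * sqrt (1 - x\<^sup>2) ^ k) has_integral (F 0 - F (-1)) + (- F 1 - - F 0)) {-1..1}"
    by (rule has_integral_combine[OF _ _ left right]) auto
  thus ?thesis by (simp add: F_def add.commute)
qed

lemma borel_measurable_cball_abs_fst:
  "(\<lambda>p::real \<times> 'a::euclidean_space. indicator (cball 0 1) p * ennreal \<bar>fst p\<bar>) \<in> borel_measurable borel"
proof -
  have [measurable]: "(\<lambda>p::real \<times> 'a. \<bar>fst p\<bar>) \<in> borel_measurable borel"
    by (intro borel_measurable_continuous_onI continuous_intros)
  show ?thesis by (intro borel_measurable_indicator_cball_mult) measurable
qed

text \<open>The slice of the unit ball at first coordinate \<open>x\<close> is a ball of radius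
  \<open>sqrt (1 - x\<^sup>2)\<close> in the remaining space, which leaves the one-dimensional
  integral computed above.\<close>

lemma nn_integral_cball_abs_fst:
  "(\<integral>\<^sup>+p. indicator (cball 0 1 :: (real \<times> 'a::euclidean_space) set) p * ennreal \<bar>fst p\<bar> \<partial>lborel) =
    ennreal (2 / (real DIM('a) + 2) * unit_ball_vol DIM('a))"
proof -
  define V where "V = unit_ball_vol (real DIM('a))"
  have V: "0 \<le> V" by (simp add: V_def)
  have "(\<integral>\<^sup>+p. indicator (cball 0 1 :: (real \<times> 'a) set) p * ennreal \<bar>fst p\<bar> \<partial>lborel) =
    (\<integral>\<^sup>+p. indicator (cball 0 1 :: (real \<times> 'a) set) p * ennreal \<bar>fst p\<bar> \<partial>(lborel \<Otimes>\<^sub>M lborel))"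
    by (simp add: lborel_prod)
  also have "\<dots> = (\<integral>\<^sup>+x. \<integral>\<^sup>+y. indicator (cball 0 1 :: (real \<times> 'a) set) (x, y) * ennreal \<bar>x\<bar> \<partial>lborel \<partial>lborel)"
    by (subst lborel.nn_integral_fst[symmetric]) (simp_all add: lborel_prod borel_measurable_cball_abs_fst)
  also have "\<dots> = (\<integral>\<^sup>+x. ennreal V * ennreal (indicator {-1..1} x * (\<bar>x\<bar> * sqrt (1 - x\<^sup>2) ^ DIM('a))) \<partial>lborel)"
  proof (rule nn_integral_cong)
    fix x :: real
    show "(\<integral>\<^sup>+y. indicator (cball 0 1 :: (real \<times> 'a) set) (x, y) * ennreal \<bar>x\<bar> \<partial>lborel) =
       ennreal V * ennreal (indicator {-1..1} x * (\<bar>x\<bar> * sqrt (1 - x\<^sup>2) ^ DIM('a)))"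
    proof (cases "x \<in> {-1..1}")
      case True
      hence x2: "x\<^sup>2 \<le> 1" by (simp add: abs_square_le_1 abs_le_iff)
      have "(\<integral>\<^sup>+y. indicator (cball 0 1 :: (real \<times> 'a) set) (x, y) * ennreal \<bar>x\<bar> \<partial>lborel) =
        (\<integral>\<^sup>+y. ennreal \<bar>x\<bar> * indicator (cball 0 (sqrt (1 - x\<^sup>2)) :: 'a set) y \<partial>lborel)"
      proof (rule nn_integral_cong)
        fix y :: 'a
        have "norm (x, y) \<le> 1 \<longleftrightarrow> (norm y)\<^sup>2 \<le> 1 - x\<^sup>2"
          by (simp add: norm_Pair le_diff_eq add.commute)
        also have "\<dots> \<longleftrightarrow> norm y \<le> sqrt (1 - x\<^sup>2)"
          using real_sqrt_le_iff[of "(norm y)\<^sup>2" "1 - x\<^sup>2"] by simp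
        finally have "norm (x, y) \<le> 1 \<longleftrightarrow> norm y \<le> sqrt (1 - x\<^sup>2)" .
        thus "indicator (cball 0 1 :: (real \<times> 'a) set) (x, y) * ennreal \<bar>x\<bar> =
          ennreal \<bar>x\<bar> * indicator (cball 0 (sqrt (1 - x\<^sup>2)) :: 'a set) y"
          by (simp add: indicator_def)
      qed
      also have "\<dots> = ennreal \<bar>x\<bar> * ennreal (V * sqrt (1 - x\<^sup>2) ^ DIM('a))"
        using x2 by (subst nn_integral_cmult) (simp_all add: emeasure_cball V_def borel_measurable_indicator)
      also have "\<dots> = ennreal V * ennreal (indicator {-1..1} x * (\<bar>x\<bar> * sqrt (1 - x\<^sup>2) ^ DIM('a)))"
        using True x2 V by (simp add: ennreal_mult[symmetric] mult_ac)
      finally show ?thesis .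
    next
      case False
      hence "\<bar>x\<bar> > 1" by auto
      hence "norm (x, y) > 1" for y :: 'a
        using norm_fst_le[of x y] by simp
      hence "(\<integral>\<^sup>+y. indicator (cball 0 1 :: (real \<times> 'a) set) (x, y) * ennreal \<bar>x\<bar> \<partial>lborel) =
        (\<integral>\<^sup>+y. 0 \<partial>(lborel :: 'a measure))"
        by (intro nn_integral_cong) (simp add: indicator_def not_le)
      thus ?thesis using False by simp
    qed
  qed
  also have "\<dots> = ennreal V * (\<integral>\<^sup>+x. ennreal (indicator {-1..1} x * (\<bar>x\<bar> * sqrt (1 - x\<^sup>2) ^ DIM('a))) \<partial>lborel)"
    by (rule nn_integral_cmult) simp
  also have "\<dots> = ennreal V * ennreal (2 / (real DIM('a) + 2))"
  proof -
    have "(\<integral>\<^sup>+x. ennreal (indicator {-1..1} x * (\<bar>x\<bar> * sqrt (1 - x\<^sup>2) ^ DIM('a))) \<partial>lborel) =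
        ennreal (2 / (real DIM('a) + 2))"
      by (rule nn_integral_has_integral_lebesgue[OF _ has_integral_abs_mult_sqrt_power])
        (auto simp: abs_square_le_1 abs_le_iff)
    thus ?thesis by (rule arg_cong)
  qed
  also have "\<dots> = ennreal (2 / (real DIM('a) + 2) * V)"
    using V by (subst mult.commute, subst ennreal_mult[symmetric]) simp_all
  finally show ?thesis by (simp only: V_def)
qed

text \<open>The norm integrates to \<open>2/3 * pi\<close> over the disc, so the ratio of the two
  integrals is the planar threshold \<open>2/pi\<close>.\<close>

lemma nn_integral_cball_abs_vec2:
  "(\<integral>\<^sup>+x. indicator (cball 0 1 :: (real^2) set) x * ennreal \<bar>x $ 1\<bar> \<partial>lborel) = ennreal (4 / 3)"
proof -
  let ?T = "\<lambda>x::real^2. (x $ 1, x $ 2)"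
  have T: "norm (?T x) = norm x" for x
    by (simp add: norm_Pair norm_vec_def L2_set_def UNIV_2)
  have "(\<integral>\<^sup>+x. indicator (cball 0 1 :: (real^2) set) x * ennreal \<bar>x $ 1\<bar> \<partial>lborel) =
    (\<integral>\<^sup>+x. indicator (cball 0 1) (?T x) * ennreal \<bar>fst (?T x)\<bar> \<partial>lborel)"
    by (rule nn_integral_cong) (simp add: T indicator_def)
  also have "\<dots> = (\<integral>\<^sup>+p. indicator (cball 0 1) p * ennreal \<bar>fst p\<bar> \<partial>distr lborel borel ?T)"
    by (rule nn_integral_distr[symmetric]) (simp_all add: borel_measurable_cball_abs_fst)
  also have "\<dots> = ennreal (4 / 3)"
    unfolding lborel_distr_vec2 nn_integral_cball_abs_fst by simp
  finally show ?thesis .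
qed

text \<open>The norm integrates to \<open>pi\<close> over the ball, so the ratio is the spatial
  threshold \<open>1/2\<close>.\<close>

lemma nn_integral_cball_abs_vec3:
  "(\<integral>\<^sup>+x. indicator (cball 0 1 :: (real^3) set) x * ennreal \<bar>x $ 1\<bar> \<partial>lborel) = ennreal (pi / 2)"
proof -
  let ?T = "\<lambda>x::real^3. (x $ 1, x $ 2, x $ 3)"
  have T: "norm (?T x) = norm x" for x
    unfolding norm_Pair norm_vec_def L2_set_def sum_3 by (simp add: add.assoc)
  have "(\<integral>\<^sup>+x. indicator (cball 0 1 :: (real^3) set) x * ennreal \<bar>x $ 1\<bar> \<partial>lborel) =
    (\<integral>\<^sup>+x. indicator (cball 0 1) (?T x) * ennreal \<bar>fst (?T x)\<bar> \<partial>lborel)"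
    by (rule nn_integral_cong) (simp add: T indicator_def)
  also have "\<dots> = (\<integral>\<^sup>+p. indicator (cball 0 1) p * ennreal \<bar>fst p\<bar> \<partial>distr lborel borel ?T)"
    by (rule nn_integral_distr[symmetric]) (simp_all add: borel_measurable_cball_abs_fst)
  also have "\<dots> = ennreal (pi / 2)"
    unfolding lborel_distr_vec3 nn_integral_cball_abs_fst by (simp add: unit_ball_vol_2)
  finally show ?thesis .
qed

section \<open>Zonotopes containing a ball\<close>

text \<open>Transversally to \<open>x\<close> the norm curves upwards to second order, while the sum
  stays affine until some \<open>u i \<bullet> x\<close> changes sign.\<close>

lemma zonotope_gap_pointwise:
  fixes u :: "nat \<Rightarrow> 'a::euclidean_space"
  assumes dim: "2 \<le> DIM('a)" and r: "0 \<le> r" and s: "0 < s" "s \<le> 1"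
    and h: "\<And>y. r * norm y \<le> (\<Sum>i<n. \<bar>u i \<bullet> y\<bar>)"
    and x: "norm x \<le> 1" "\<And>i. i < n \<Longrightarrow> s * norm (u i) \<le> \<bar>u i \<bullet> x\<bar>"
  shows "r * (norm x + s\<^sup>2 / 3) \<le> (\<Sum>i<n. \<bar>u i \<bullet> x\<bar>)"
proof -
  \<comment> \<open>Dimension at least two provides a direction orthogonal to
    \<open>x\<close>.\<close>
  obtain y where y: "y \<noteq> 0" "orthogonal x y"
    using orthogonal_to_vector_exists[OF dim] by blast
  define e where "e = (s / norm y) *\<^sub>R y"
  have ne: "norm e = s" using y s by (simp add: e_def)
  have xe: "x \<bullet> e = 0" using y by (simp add: e_def orthogonal_def)
  have "(norm (x + e))\<^sup>2 = (norm x)\<^sup>2 + s\<^sup>2" "(norm (x - e))\<^sup>2 = (norm x)\<^sup>2 + s\<^sup>2"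
    using norm_add_Pythagorean[of x e] norm_add_Pythagorean[of x "- e"] xe ne
    by (simp_all add: orthogonal_def)
  hence n1: "norm (x + e) = sqrt ((norm x)\<^sup>2 + s\<^sup>2)" "norm (x - e) = sqrt ((norm x)\<^sup>2 + s\<^sup>2)"
    using real_sqrt_unique[OF _ norm_ge_zero] by metis+
  \<comment> \<open>The shift by \<open>e\<close> is too short to change the sign of
    \<open>u i \<bullet> x\<close>, so the two absolute values add up without cancellation.\<close>
  have split: "\<bar>u i \<bullet> (x + e)\<bar> + \<bar>u i \<bullet> (x - e)\<bar> = 2 * \<bar>u i \<bullet> x\<bar>" if "i < n" for i
  proof -
    have "\<bar>u i \<bullet> e\<bar> \<le> norm (u i) * norm e" by (rule Cauchy_Schwarz_ineq2)
    also have "\<dots> \<le> \<bar>u i \<bullet> x\<bar>" using x(2)[OF that] by (simp add: ne mult.commute)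
    finally show ?thesis by (simp add: inner_add_right inner_diff_right)
  qed
  \<comment> \<open>Squaring, the excess on the left is at most \<open>2/3 + 1/9 < 1\<close> times
    \<open>s\<^sup>2\<close>, because \<open>norm x\<close> and \<open>s\<close> are at most
    1.\<close>
  have "norm x + s\<^sup>2 / 3 \<le> sqrt ((norm x)\<^sup>2 + s\<^sup>2)"
  proof (rule real_le_rsqrt)
    have s2: "s\<^sup>2 \<le> 1" using s by (simp add: power_le_one)
    have "norm x * s\<^sup>2 \<le> 1 * s\<^sup>2" using x(1) by (intro mult_right_mono) auto
    moreover have "s\<^sup>2 * s\<^sup>2 \<le> 1 * s\<^sup>2" using s2 by (intro mult_right_mono) auto
    moreover have "(norm x + s\<^sup>2 / 3)\<^sup>2 = (norm x)\<^sup>2 + 2 / 3 * (norm x * s\<^sup>2) + s\<^sup>2 * s\<^sup>2 / 9"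
      by (simp add: power2_eq_square field_simps)
    ultimately show "(norm x + s\<^sup>2 / 3)\<^sup>2 \<le> (norm x)\<^sup>2 + s\<^sup>2"
      using zero_le_power2[of s] by linarith
  qed
  hence "2 * (r * (norm x + s\<^sup>2 / 3)) \<le> 2 * (r * sqrt ((norm x)\<^sup>2 + s\<^sup>2))"
    using r by (simp add: mult_left_mono)
  also have "\<dots> = r * norm (x + e) + r * norm (x - e)" by (simp add: n1)
  also have "\<dots> \<le> (\<Sum>i<n. \<bar>u i \<bullet> (x + e)\<bar>) + (\<Sum>i<n. \<bar>u i \<bullet> (x - e)\<bar>)"
    by (intro add_mono h)
  also have "\<dots> = (\<Sum>i<n. 2 * \<bar>u i \<bullet> x\<bar>)"
    unfolding sum.distrib[symmetric] by (intro sum.cong) (auto simp: split)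
  finally show ?thesis by (simp add: sum_distrib_left[symmetric])
qed

text \<open>The pointwise gap integrated over the unit ball. The parameter \<open>s\<close> is left
  free: a larger value widens the gap but shrinks the region \<open>G\<close> where it is available.
  Here \<open>K\<close> is the integral of one coordinate's absolute value, and each generator
  contributes \<open>norm (u i) * K\<close>.\<close>

lemma zonotope_gap:
  fixes u :: "nat \<Rightarrow> real^'n::{finite,wellorder}" and k :: 'n
  assumes dim: "2 \<le> CARD('n)" and r: "0 \<le> r" and s: "0 < s" "s \<le> 1"
    and sumu: "(\<Sum>i<n. norm (u i)) \<le> 1"
    and h: "\<And>y. r * norm y \<le> (\<Sum>i<n. \<bar>u i \<bullet> y\<bar>)"
    and K: "(\<integral>\<^sup>+x. indicator (cball 0 1 :: (real^'n::_) set) x * ennreal \<bar>x $ k\<bar> \<partial>lborel) = ennreal K"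
      "0 \<le> K"
    and V: "V = unit_ball_vol CARD('n)" "real n * 2 ^ CARD('n) * s \<le> V"
  shows "r * (CARD('n) / (CARD('n) + 1) * V + s\<^sup>2 / 3 * (V - real n * 2 ^ CARD('n) * s)) \<le> K"
proof -
  define J where "J = CARD('n) / (CARD('n) + 1) * V"
  define a where "a = r * (s\<^sup>2 / 3)"
  define S where "S i = cball 0 1 \<inter> {x. \<bar>u i \<bullet> x\<bar> < s * norm (u i)}" for i
  define G where "G = cball 0 1 - (\<Union>i<n. S i)"
  have V0: "0 \<le> V" using V by simp
  have J0: "0 \<le> J" using V0 by (simp add: J_def)
  have a0: "0 \<le> a" using r by (simp add: a_def)
  have cball_meas: "(\<lambda>x. indicator (cball 0 1) x * g x) \<in> borel_measurable lborel"
    if "g \<in> borel_measurable borel" for g :: "real^'n::_ \<Rightarrow> ennreal"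
    using borel_measurable_indicator_cball_mult[OF that] unfolding measurable_lborel2 .
  have S_meas [measurable]: "S i \<in> sets borel" for i
  proof -
    have "open {x. \<bar>u i \<bullet> x\<bar> < s * norm (u i)}"
      by (intro open_Collect_less continuous_intros)
    thus ?thesis unfolding S_def by (intro sets.Int borel_open borel_closed) auto
  qed
  have G_meas [measurable]: "G \<in> sets borel"
    unfolding G_def by (intro sets.Diff sets.finite_UN) auto
  \<comment> \<open>Union bound: what the \<open>n\<close> slabs leave of the ball has volume at
    least \<open>V - real n * 2 ^ CARD('n) * s\<close>.\<close>
  have "ennreal V = emeasure lborel (cball 0 1 :: (real^'n::_) set)"
    using V by (simp add: emeasure_cball)
  also have "\<dots> \<le> emeasure lborel (G \<union> (\<Union>i<n. S i))"
    by (intro emeasure_mono) (auto simp: G_def)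
  also have "\<dots> \<le> emeasure lborel G + emeasure lborel (\<Union>i<n. S i)"
    by (intro emeasure_subadditive) auto
  also have "emeasure lborel (\<Union>i<n. S i) \<le> (\<Sum>i<n. emeasure lborel (S i))"
    by (intro emeasure_subadditive_finite) auto
  also have "\<dots> \<le> (\<Sum>i<n. ennreal (2 ^ CARD('n) * s))"
    unfolding S_def using s by (intro sum_mono emeasure_cball_slab_le) simp
  also have "\<dots> = ennreal (real n * 2 ^ CARD('n) * s)"
    using s by (simp add: ennreal_of_nat_eq_real_of_nat ennreal_mult[symmetric] mult.assoc)
  finally have "ennreal V - ennreal (real n * 2 ^ CARD('n) * s) \<le> emeasure lborel G"
    by (simp add: ennreal_minus_le_iff add.commute)
  hence Gge: "ennreal (V - real n * 2 ^ CARD('n) * s) \<le> emeasure lborel G"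
    using s by (simp add: ennreal_minus)
  have "ennreal (r * J) + ennreal (a * (V - real n * 2 ^ CARD('n) * s))
     \<le> ennreal r * ennreal J + ennreal a * emeasure lborel G"
    using r J0 a0 Gge by (simp add: ennreal_mult mult_left_mono add_left_mono ennreal_mult')
  also have "\<dots> = (\<integral>\<^sup>+x. ennreal r * (indicator (cball 0 1 :: (real^'n::_) set) x * ennreal (norm x)) \<partial>lborel)
      + (\<integral>\<^sup>+x. ennreal a * indicator G x \<partial>lborel)"
  proof -
    have "(\<integral>\<^sup>+x. ennreal r * (indicator (cball 0 1 :: (real^'n::_) set) x * ennreal (norm x)) \<partial>lborel) =
      ennreal r * ennreal J"
      by (subst nn_integral_cmult[OF cball_meas], simp)
        (simp add: nn_integral_cball_norm J_def V)
    moreover have "(\<integral>\<^sup>+x. ennreal a * indicator G x \<partial>lborel) = ennreal a * emeasure lborel G"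
      by (subst nn_integral_cmult) simp_all
    ultimately show ?thesis by simp
  qed
  also have "\<dots> = (\<integral>\<^sup>+x. ennreal r * (indicator (cball 0 1 :: (real^'n::_) set) x * ennreal (norm x))
      + ennreal a * indicator G x \<partial>lborel)"
    by (intro nn_integral_add[symmetric] borel_measurable_times_ennreal[of "\<lambda>_. _"] cball_meas) simp_all
  also have "\<dots> \<le> (\<integral>\<^sup>+x. (\<Sum>i<n. indicator (cball 0 1) x * ennreal \<bar>u i \<bullet> x\<bar>) \<partial>lborel)"
  proof (rule nn_integral_mono)
    fix x :: "real^'n::_"
    show "ennreal r * (indicator (cball 0 1) x * ennreal (norm x)) + ennreal a * indicator G x
       \<le> (\<Sum>i<n. indicator (cball 0 1) x * ennreal \<bar>u i \<bullet> x\<bar>)"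
    proof (cases "x \<in> cball 0 1")
      case True
      \<comment> \<open>On \<open>G\<close> the improved bound applies; on the slabs only
        \<open>h\<close> itself.\<close>
      have "r * norm x + a * indicator G x \<le> (\<Sum>i<n. \<bar>u i \<bullet> x\<bar>)"
      proof (cases "x \<in> G")
        case inG: True
        have "r * (norm x + s\<^sup>2 / 3) \<le> (\<Sum>i<n. \<bar>u i \<bullet> x\<bar>)"
          using True inG dim r s h
          by (intro zonotope_gap_pointwise) (auto simp: G_def S_def not_less)
        thus ?thesis using inG by (simp add: a_def algebra_simps)
      qed (use h in simp)
      hence "ennreal (r * norm x + a * indicator G x) \<le> ennreal (\<Sum>i<n. \<bar>u i \<bullet> x\<bar>)"
        by (rule ennreal_leI)
      also have "ennreal (r * norm x + a * indicator G x) =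
          ennreal r * (indicator (cball 0 1) x * ennreal (norm x)) + ennreal a * indicator G x"
        using True r a0 by (simp add: ennreal_plus[symmetric] ennreal_mult[symmetric] indicator_def
          del: ennreal_plus)
      also have "ennreal (\<Sum>i<n. \<bar>u i \<bullet> x\<bar>) = (\<Sum>i<n. indicator (cball 0 1) x * ennreal \<bar>u i \<bullet> x\<bar>)"
        using True by (simp add: sum_ennreal)
      finally show ?thesis .
    next
      case False
      thus ?thesis by (simp add: G_def)
    qed
  qed
  also have "\<dots> = (\<Sum>i<n. \<integral>\<^sup>+x. indicator (cball 0 1) x * ennreal \<bar>u i \<bullet> x\<bar> \<partial>lborel)"
    by (intro nn_integral_sum cball_meas) simp
  also have "\<dots> = (\<Sum>i<n. ennreal (norm (u i) * K))"
  proof (rule sum.cong[OF refl])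
    fix i
    have "(\<integral>\<^sup>+x. indicator (cball 0 1) x * ennreal \<bar>u i \<bullet> x\<bar> \<partial>lborel) =
       (\<integral>\<^sup>+x. indicator (cball 0 1 :: (real^'n::_) set) x * ennreal \<bar>norm (u i) * x $ k\<bar> \<partial>lborel)"
      by (rule nn_integral_cball_inner) simp
    also have "\<dots> = (\<integral>\<^sup>+x. ennreal (norm (u i)) * (indicator (cball 0 1 :: (real^'n::_) set) x * ennreal \<bar>x $ k\<bar>) \<partial>lborel)"
      by (simp add: abs_mult ennreal_mult mult_ac)
    also have "\<dots> = ennreal (norm (u i)) * ennreal K"
      by (subst nn_integral_cmult[OF cball_meas], simp) (simp add: K)
    finally show "(\<integral>\<^sup>+x. indicator (cball 0 1) x * ennreal \<bar>u i \<bullet> x\<bar> \<partial>lborel) = ennreal (norm (u i) * K)"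
      using K by (simp add: ennreal_mult)
  qed
  also have "\<dots> = ennreal ((\<Sum>i<n. norm (u i)) * K)"
    using K by (simp add: sum_ennreal sum_distrib_right)
  also have "\<dots> \<le> ennreal K"
    using K sumu by (intro ennreal_leI mult_left_le_one_le sum_nonneg) auto
  finally have "ennreal (r * J + a * (V - real n * 2 ^ CARD('n) * s)) \<le> ennreal K"
    using r J0 a0 V by (simp add: ennreal_plus)
  hence "r * J + a * (V - real n * 2 ^ CARD('n) * s) \<le> K"
    using K by simp
  thus ?thesis by (simp add: J_def a_def algebra_simps)
qed

section \<open>Qubit effects as Bloch vectors\<close>

text \<open>Half the trace, so that the weights of a POVM sum to 1. Taking the real part makes it a
  real-linear functional on all matrices.\<close>

definition weight :: "qop \<Rightarrow> real" where
  "weight A = Re (A$0$0 + A$1$1) / 2"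

text \<open>Unnormalised Bloch vector: a Hermitian \<open>A\<close> equals \<open>weight A\<close> times the identity plus
  \<open>bloch A \<bullet> \<sigma>\<close>.\<close>
definition bloch :: "qop \<Rightarrow> real^3" where
  "bloch A = vector [Re (A$0$1 + A$1$0) / 2, Im (A$1$0 - A$0$1) / 2, Re (A$0$0 - A$1$1) / 2]"

text \<open>In the type \<open>2\<close> the numeral \<open>2\<close> equals \<open>0\<close>; the
  matrices here are indexed by 0 and 1 rather than by 1 and 2.\<close>

lemma UNIV_2': "(UNIV :: 2 set) = {0, 1}"
  using UNIV_2 by auto

lemma forall_2': "(\<forall>i::2. P i) \<longleftrightarrow> P 0 \<and> P 1"
  by (metis UNIV_2' UNIV_I insert_iff empty_iff)

lemma linear_weight: "linear weight"
  by (rule linearI) (simp_all add: weight_def field_simps)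

lemma linear_bloch: "linear bloch"
  by (rule linearI) (simp_all add: bloch_def vec_eq_iff forall_3 field_simps)

lemma weight_mat_1: "weight (mat 1) = 1"
  by (simp add: weight_def mat_def)

lemma bloch_mat_1: "bloch (mat 1) = 0"
  by (simp add: bloch_def mat_def vec_eq_iff forall_3)

lemma bloch_ndotsigma: "bloch (ndotsigma n) = n"
  by (simp add: bloch_def ndotsigma_def sigma_x_def sigma_y_def sigma_z_def vec_eq_iff forall_3)

lemma psd_imp_quadratic_form:
  fixes A :: qop
  assumes "psd A"
  shows "0 \<le> Re (cnj x * (A$0$0 * x + A$0$1 * y) + cnj y * (A$1$0 * x + A$1$1 * y))"
proof -
  define v :: "complex^2" where "v = (\<chi> i. if i = 0 then x else y)"
  have "0 \<le> Re (\<Sum>i\<in>UNIV. cnj (v$i) * (A *v v)$i)"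
    using assms unfolding psd_def Let_def by blast
  thus ?thesis by (simp add: UNIV_2' matrix_vector_mult_def v_def)
qed

text \<open>A Hermitian \<open>A\<close> has eigenvalues \<open>weight A\<close> plus and minus
  \<open>norm (bloch A)\<close>, so the claim says that the smaller one is nonnegative. The proof
  derives it from nonnegativity of the determinant.\<close>

lemma norm_bloch_le:
  assumes "psd A"
  shows "norm (bloch A) \<le> weight A"
proof -
  define a d where "a = Re (A$0$0)" and "d = Re (A$1$1)"
  define p q where "p = Re (A$0$1 + A$1$0) / 2" and "q = Im (A$1$0 - A$0$1) / 2"
  \<comment> \<open>The real part of the form sees the off-diagonal entries only through the
    symmetrised \<open>p\<close> and \<open>q\<close>.\<close>
  have Q: "0 \<le> a * (x1\<^sup>2 + x2\<^sup>2) + d * (y1\<^sup>2 + y2\<^sup>2) +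
      2 * (p * (x1 * y1 + x2 * y2) + q * (x1 * y2 - x2 * y1))" for x1 x2 y1 y2
    using psd_imp_quadratic_form[OF assms, of "Complex x1 x2" "Complex y1 y2"]
    by (simp add: a_def d_def p_def q_def power2_eq_square algebra_simps
        add_divide_distrib diff_divide_distrib)
  have a: "0 \<le> a" using Q[of 1 0 0 0] by simp
  have d: "0 \<le> d" using Q[of 0 0 1 0] by simp
  \<comment> \<open>For \<open>a\<close> nonzero, the test vector minimises the form in its first
    component with the second fixed to \<open>a\<close>; the roles are exchanged if only
    \<open>d\<close> is nonzero. If both vanish, the form is linear in its first component and a
    suitable choice makes it negative unless \<open>p = q = 0\<close>.\<close>
  have det: "p\<^sup>2 + q\<^sup>2 \<le> a * d"
  proof (cases "a = 0")
    case False
    have "0 \<le> a * (a * d - (p\<^sup>2 + q\<^sup>2))"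
      using Q[of "-p" q a 0] by (simp add: power2_eq_square algebra_simps)
    thus ?thesis using a False by (simp add: zero_le_mult_iff)
  next
    case True
    have "p\<^sup>2 + q\<^sup>2 \<le> 0"
    proof (cases "d = 0")
      case True
      thus ?thesis using \<open>a = 0\<close> Q[of "-p" q 1 0] by (simp add: power2_eq_square algebra_simps)
    next
      case False
      have "0 \<le> d * - (p\<^sup>2 + q\<^sup>2)"
        using \<open>a = 0\<close> Q[of d 0 "-p" "-q"] by (simp add: power2_eq_square algebra_simps)
      thus ?thesis using d False by (simp only: zero_le_mult_iff) linarith
    qed
    thus ?thesis using True by simp
  qed
  have "(norm (bloch A))\<^sup>2 = p\<^sup>2 + q\<^sup>2 + ((a - d) / 2)\<^sup>2"
    unfolding power2_norm_eq_inner
    by (simp add: bloch_def inner_vec_def sum_3 p_def q_def a_def d_def power2_eq_square)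
  also have "\<dots> \<le> ((a + d) / 2)\<^sup>2"
    using det by (simp add: power2_eq_square field_simps)
  finally have "norm (bloch A) \<le> (a + d) / 2"
    by (rule power2_le_imp_le) (use a d in simp)
  thus ?thesis by (simp add: weight_def a_def d_def)
qed

lemma noisy_meas_nth_0: "noisy_meas r n ! 0 = (1/2) *\<^sub>R (mat 1 + r *\<^sub>R ndotsigma n)"
  and noisy_meas_nth_1: "noisy_meas r n ! Suc 0 = (1/2) *\<^sub>R (mat 1 - r *\<^sub>R ndotsigma n)"
  and length_noisy_meas: "length (noisy_meas r n) = 2"
  by (simp_all add: noisy_meas_def)

lemma sum_norm_bloch_le:
  assumes "povm Pm"
  shows "(\<Sum>i<length Pm. norm (bloch (Pm ! i))) \<le> 1"
proof -
  have "(\<Sum>i<length Pm. norm (bloch (Pm ! i))) \<le> (\<Sum>i<length Pm. weight (Pm ! i))"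
    using assms by (intro sum_mono norm_bloch_le) (simp add: povm_def)
  also have "\<dots> = weight (\<Sum>i<length Pm. Pm ! i)"
    by (simp add: linear_sum[OF linear_weight])
  also have "\<dots> = 1" using assms by (simp add: povm_def weight_mat_1)
  finally show ?thesis .
qed

text \<open>The Bloch vectors of the POVM sum to zero, so \<open>r *\<^sub>R n\<close> is their
  combination with coefficients \<open>2 * p 0 i - 1\<close>, which lie between -1 and 1. Hence it
  lies in the zonotope they generate, whose support function in direction \<open>n\<close> is the
  right-hand side.\<close>

lemma simulation_radius_le:
  assumes povm: "povm Pm" and sim: "simulates Pm F" and n: "noisy_meas r n \<in> F" "norm n = 1"
  shows "r \<le> (\<Sum>i<length Pm. \<bar>bloch (Pm ! i) \<bullet> n\<bar>)"
proof -
  let ?M = "noisy_meas r n"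
  from sim obtain P where "\<forall>M\<in>F. (\<forall>a<length M. M ! a = (\<Sum>i<length Pm. P M a i *\<^sub>R (Pm ! i)))
        \<and> (\<forall>a<length M. \<forall>i<length Pm. 0 \<le> (P M a i :: real))
        \<and> (\<forall>i<length Pm. (\<Sum>a<length M. P M a i) = 1)"
    unfolding simulates_def by (rule exE)
  from bspec[OF this n(1)] obtain p where
    p: "\<forall>a<length ?M. ?M ! a = (\<Sum>i<length Pm. p a i *\<^sub>R (Pm ! i))"
      "\<forall>a<length ?M. \<forall>i<length Pm. 0 \<le> (p a i :: real)"
      "\<forall>i<length Pm. (\<Sum>a<length ?M. p a i) = 1"
    by (elim conjE) (rule that)
  have p01: "0 \<le> p 0 i" "p 0 i \<le> 1" if "i < length Pm" for i
  proof -
    show "0 \<le> p 0 i" using p(2) that by (simp add: length_noisy_meas)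
    have "p 0 i + p 1 i = 1" "0 \<le> p 1 i"
      using p(2,3) that by (auto simp: length_noisy_meas numeral_2_eq_2)
    thus "p 0 i \<le> 1" by simp
  qed
  have "(\<Sum>i<length Pm. p 0 i *\<^sub>R bloch (Pm ! i)) = bloch (\<Sum>i<length Pm. p 0 i *\<^sub>R (Pm ! i))"
    by (simp add: linear_sum[OF linear_bloch] linear_cmul[OF linear_bloch])
  also have "\<dots> = bloch (noisy_meas r n ! 0)" using p(1) by (simp add: length_noisy_meas)
  also have "\<dots> = (r / 2) *\<^sub>R n"
    by (simp add: noisy_meas_nth_0 linear_cmul[OF linear_bloch] linear_add[OF linear_bloch]
        bloch_mat_1 bloch_ndotsigma)
  finally have e1: "(\<Sum>i<length Pm. p 0 i *\<^sub>R bloch (Pm ! i)) = (r / 2) *\<^sub>R n" .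
  have "(\<Sum>i<length Pm. bloch (Pm ! i)) = bloch (\<Sum>i<length Pm. Pm ! i)"
    by (simp add: linear_sum[OF linear_bloch])
  hence e2: "(\<Sum>i<length Pm. bloch (Pm ! i)) = 0"
    using povm by (simp add: povm_def bloch_mat_1)
  have "r = (2 *\<^sub>R (\<Sum>i<length Pm. p 0 i *\<^sub>R bloch (Pm ! i)) - (\<Sum>i<length Pm. bloch (Pm ! i))) \<bullet> n"
    using n by (simp add: e1 e2 power2_norm_eq_inner[symmetric])
  also have "\<dots> = (\<Sum>i<length Pm. (2 * p 0 i - 1) * (bloch (Pm ! i) \<bullet> n))"
    by (simp add: inner_diff_left inner_sum_left sum_distrib_left sum_subtractf[symmetric] algebra_simps)
  also have "\<dots> \<le> (\<Sum>i<length Pm. \<bar>bloch (Pm ! i) \<bullet> n\<bar>)"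
  proof (rule sum_mono)
    fix i assume "i \<in> {..<length Pm}"
    hence "\<bar>2 * p 0 i - 1\<bar> \<le> 1" using p01[of i] by auto
    hence "\<bar>(2 * p 0 i - 1) * (bloch (Pm ! i) \<bullet> n)\<bar> \<le> \<bar>bloch (Pm ! i) \<bullet> n\<bar>"
      by (simp add: abs_mult mult_left_le_one_le)
    thus "(2 * p 0 i - 1) * (bloch (Pm ! i) \<bullet> n) \<le> \<bar>bloch (Pm ! i) \<bullet> n\<bar>" by linarith
  qed
  finally show ?thesis .
qed

lemma povm_length_pos: "povm Pm \<Longrightarrow> 1 \<le> length Pm"
proof (cases Pm)
  case Nil
  assume "povm Pm"
  hence "mat 1 = (0 :: qop)" using Nil by (simp add: povm_def)
  hence "weight (mat 1) = weight 0" by simp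
  thus ?thesis by (simp add: weight_mat_1) (simp add: weight_def)
qed simp

section \<open>Projective measurements and steering of the Werner state\<close>

lemma psd_scaleR:
  fixes A :: "complex^'n^'n"
  assumes "psd A" "0 \<le> c"
  shows "psd (c *\<^sub>R A)"
  unfolding psd_def
proof
  fix v :: "complex^'n"
  have "(\<Sum>i\<in>UNIV. cnj (v$i) * ((c *\<^sub>R A) *v v)$i) = c *\<^sub>R (\<Sum>i\<in>UNIV. cnj (v$i) * (A *v v)$i)"
    by (simp add: matrix_vector_mult_def scaleR_sum_right sum_distrib_left)
  thus "let z = \<Sum>i\<in>UNIV. cnj (v$i) * ((c *\<^sub>R A) *v v)$i in Im z = 0 \<and> 0 \<le> Re z"
    using assms by (simp add: psd_def Let_def)
qed

text \<open>The quadratic form at \<open>v\<close> equals \<open>N + n \<bullet> w\<close>, where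
  \<open>w\<close> is the Bloch vector of the unnormalised pure state \<open>v\<close> and has
  length \<open>N\<close>, the squared norm of \<open>v\<close>. Cauchy-Schwarz then gives
  positivity.\<close>

lemma psd_one_plus_ndotsigma:
  assumes "norm n \<le> 1"
  shows "psd (mat 1 + ndotsigma n)"
  unfolding psd_def
proof
  fix v :: "complex^2"
  define x1 x2 y1 y2 where "x1 = Re (v$0)" and "x2 = Im (v$0)" and "y1 = Re (v$1)" and "y2 = Im (v$1)"
  have v: "v$0 = Complex x1 x2" "v$1 = Complex y1 y2"
    by (simp_all add: x1_def x2_def y1_def y2_def)
  define N where "N = x1\<^sup>2 + x2\<^sup>2 + y1\<^sup>2 + y2\<^sup>2"
  define w :: "real^3" where
    "w = vector [2 * (x1 * y1 + x2 * y2), 2 * (x1 * y2 - x2 * y1), x1\<^sup>2 + x2\<^sup>2 - y1\<^sup>2 - y2\<^sup>2]"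
  have N0: "0 \<le> N" by (simp add: N_def)
  have "(norm w)\<^sup>2 = N\<^sup>2"
    unfolding power2_norm_eq_inner
    by (simp add: w_def inner_vec_def sum_3 N_def power2_eq_square algebra_simps)
  hence w: "norm w = N" using N0 by simp
  have z: "(\<Sum>i\<in>UNIV. cnj (v$i) * ((mat 1 + ndotsigma n) *v v)$i) = complex_of_real (N + n \<bullet> w)"
    by (simp add: UNIV_2' matrix_vector_mult_def mat_def ndotsigma_def sigma_x_def sigma_y_def
        sigma_z_def v N_def w_def inner_vec_def sum_3 complex_eq_iff power2_eq_square algebra_simps)
  have "\<bar>n \<bullet> w\<bar> \<le> norm n * norm w" by (rule Cauchy_Schwarz_ineq2)
  also have "\<dots> \<le> N" using assms N0 by (simp add: w mult_left_le_one_le)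
  finally show "let z = \<Sum>i\<in>UNIV. cnj (v$i) * ((mat 1 + ndotsigma n) *v v)$i in Im z = 0 \<and> 0 \<le> Re z"
    by (simp add: z Let_def)
qed

lemma ndotsigma_minus: "ndotsigma (- n) = - ndotsigma n"
  by (simp add: ndotsigma_def)

lemma povm_noisy_meas_1:
  assumes "norm n = 1"
  shows "povm (noisy_meas 1 n)"
proof -
  have "psd (noisy_meas 1 n ! 0)"
    using psd_scaleR[OF psd_one_plus_ndotsigma[of n], of "1/2"] assms by (simp add: noisy_meas_nth_0)
  moreover have "psd (noisy_meas 1 n ! Suc 0)"
    using psd_scaleR[OF psd_one_plus_ndotsigma[of "-n"], of "1/2"] assms
    by (simp add: noisy_meas_nth_1 ndotsigma_minus)
  ultimately show ?thesis
    by (auto simp: povm_def length_noisy_meas less_2_cases_iff)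
      (simp add: numeral_2_eq_2 noisy_meas_nth_0 noisy_meas_nth_1 scaleR_add_right[symmetric]
        flip: scaleR_2)
qed

text \<open>The singlet part returns half the spin-flipped effect, which reverses \<open>n\<close>;
  the white noise returns a multiple of the identity. So \<open>r\<close> scales just the Bloch
  part, and the factor \<open>1/2\<close> comes from the maximally mixed marginal.\<close>

lemma assemb_werner_noisy_meas:
  assumes "a < 2"
  shows "assemb (werner r) (noisy_meas 1 n ! a) = (1/2) *\<^sub>R (noisy_meas r (- n) ! a)"
proof -
  have h: "complex_of_real (sqrt 2) * complex_of_real (sqrt 2) = 2"
    by (simp flip: of_real_mult)
  from assms have "a = 0 \<or> a = Suc 0" by auto
  thus ?thesis
    by (auto simp: vec_eq_iff forall_2' assemb_def werner_def psi_minus_def UNIV_2'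
        noisy_meas_nth_0 noisy_meas_nth_1 mat_def ndotsigma_def sigma_x_def sigma_y_def sigma_z_def
        complex_eq_iff field_simps h)
qed

section \<open>Simulation radius and local hidden states\<close>

lemma simulation_radius_bound:
  assumes povm: "povm Pm" and sim: "simulates Pm (Pfam r)" and r: "0 \<le> r"
  shows "r \<le> 1/2 - 1/3072 / (real (length Pm))\<^sup>2"
proof -
  define N where "N = real (length Pm)"
  define t where "t = 1 / N\<^sup>2"
  have N: "1 \<le> N" using povm_length_pos[OF povm] by (simp add: N_def)
  have t: "0 < t" "t \<le> 1" using N by (simp_all add: t_def)
  have pi: "3 < pi" "pi < 4" using pi_gt3 pi_less_4 by auto
  \<comment> \<open>Both sides are homogeneous in \<open>y\<close>, so unit directions
    suffice.\<close>
  have h: "r * norm y \<le> (\<Sum>i<length Pm. \<bar>bloch (Pm ! i) \<bullet> y\<bar>)" for y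
  proof (cases "y = 0")
    case False
    define n where "n = y /\<^sub>R norm y"
    have n: "norm n = 1" "y = norm y *\<^sub>R n" using False by (simp_all add: n_def)
    have "r \<le> (\<Sum>i<length Pm. \<bar>bloch (Pm ! i) \<bullet> n\<bar>)"
      by (rule simulation_radius_le[OF povm sim _ n(1)]) (use n(1) in \<open>auto simp: Pfam_def\<close>)
    hence "norm y * r \<le> norm y * (\<Sum>i<length Pm. \<bar>bloch (Pm ! i) \<bullet> n\<bar>)"
      by (rule mult_left_mono) simp
    also have "\<dots> = (\<Sum>i<length Pm. \<bar>bloch (Pm ! i) \<bullet> (norm y *\<^sub>R n)\<bar>)"
      by (simp add: sum_distrib_left abs_mult)
    finally show ?thesis unfolding n(2)[symmetric] by (simp only: mult.commute)
  qed simp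
  have "Pm \<noteq> []" using N by (auto simp: N_def)
  \<comment> \<open>The choice \<open>s = 1 / (8 * N)\<close> makes the total slab volume at most 1,
    below the ball volume \<open>4 / 3 * pi\<close>.\<close>
  hence Ns: "real (length Pm) * 2 ^ CARD(3) * (1 / (8 * N)) = 1" by (simp add: N_def)
  have "r * (real CARD(3) / real (CARD(3) + 1) * (4 / 3 * pi) +
     (1 / (8 * N))\<^sup>2 / 3 * (4 / 3 * pi - real (length Pm) * 2 ^ CARD(3) * (1 / (8 * N)))) \<le> pi / 2"
  proof (rule zonotope_gap[where u = "\<lambda>i. bloch (Pm ! i)" and k = 1])
    show "(\<Sum>i<length Pm. norm (bloch (Pm ! i))) \<le> 1" by (rule sum_norm_bloch_le[OF povm])
    show "real (length Pm) * 2 ^ CARD(3) * (1 / (8 * N)) \<le> 4 / 3 * pi" unfolding Ns using pi by simp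
  qed (use N r h nn_integral_cball_abs_vec3 in \<open>simp_all add: unit_ball_vol_3\<close>)
  hence "r * (pi + t / 192 * (4 / 3 * pi - 1)) \<le> pi / 2"
    unfolding Ns by (simp add: t_def power2_eq_square mult_ac)
  hence main: "r * pi + r * (t / 192 * (4 / 3 * pi - 1)) \<le> pi / 2"
    by (simp add: distrib_left)
  \<comment> \<open>The gap carries a factor \<open>r\<close>, so small \<open>r\<close> is treated
    apart. For \<open>r\<close> at least \<open>1/4\<close> the gap is at least
    \<open>t / 768\<close>, and dividing by \<open>pi < 4\<close> gives the constant 3072.\<close>
  have "r + t / 3072 \<le> 1 / 2"
  proof (cases "r < 1 / 4")
    case False
    have "1 / 4 * (t / 192 * 1) \<le> r * (t / 192 * (4 / 3 * pi - 1))"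
      using False t pi by (intro mult_mono) auto
    hence "r * pi + t / 768 \<le> pi / 2" using main by linarith
    moreover have "t * pi \<le> t * 4" using t pi by (intro mult_left_mono) auto
    moreover have "(r + t / 3072) * pi = r * pi + t * pi / 3072" by (simp add: distrib_right)
    ultimately have "(r + t / 3072) * pi \<le> (1 / 2) * pi" by linarith
    thus ?thesis using pi by (subst (asm) mult_le_cancel_right_pos) auto
  qed (use t in simp)
  thus ?thesis by (simp add: t_def N_def)
qed

text \<open>Directions with vanishing second component see only the projections \<open>b\<close> of
  the Bloch vectors to the xz-plane. Projecting does not increase norms, so the two-dimensional
  zonotope bound applies.\<close>

lemma simulation_radius_bound_planar:
  assumes povm: "povm Pm" and sim: "simulates Pm (Pfam_p r)" and r: "0 \<le> r"
  shows "r \<le> 2/pi - 1/512 / (real (length Pm))\<^sup>2"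
proof -
  define N where "N = real (length Pm)"
  define t where "t = 1 / N\<^sup>2"
  define b :: "nat \<Rightarrow> real^2" where "b i = vector [bloch (Pm ! i) $ 1, bloch (Pm ! i) $ 3]" for i
  have N: "1 \<le> N" using povm_length_pos[OF povm] by (simp add: N_def)
  have t: "0 < t" "t \<le> 1" using N by (simp_all add: t_def)
  have pi: "3 < pi" "pi < 4" using pi_gt3 pi_less_4 by auto
  have norm_b: "norm (b i) \<le> norm (bloch (Pm ! i))" for i
    unfolding norm_vec_def L2_set_def sum_2 sum_3 by (rule real_sqrt_le_mono) (simp add: b_def)
  have h: "r * norm y \<le> (\<Sum>i<length Pm. \<bar>b i \<bullet> y\<bar>)" for y
  proof (cases "y = 0")
    case False
    define n where "n = y /\<^sub>R norm y"
    have n: "norm n = 1" "y = norm y *\<^sub>R n" using False by (simp_all add: n_def)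
    define n' :: "real^3" where "n' = vector [n $ 1, 0, n $ 2]"
    have n': "norm n' = 1" "n' $ 2 = 0"
      using n(1) unfolding norm_vec_def L2_set_def sum_2 sum_3 by (simp_all add: n'_def)
    have ip: "bloch (Pm ! i) \<bullet> n' = b i \<bullet> n" for i
      unfolding inner_vec_def sum_2 sum_3 by (simp add: n'_def b_def)
    have "r \<le> (\<Sum>i<length Pm. \<bar>bloch (Pm ! i) \<bullet> n'\<bar>)"
      by (rule simulation_radius_le[OF povm sim _ n'(1)]) (use n' in \<open>auto simp: Pfam_p_def\<close>)
    hence "norm y * r \<le> norm y * (\<Sum>i<length Pm. \<bar>b i \<bullet> n\<bar>)"
      unfolding ip by (rule mult_left_mono) simp
    also have "\<dots> = (\<Sum>i<length Pm. \<bar>b i \<bullet> (norm y *\<^sub>R n)\<bar>)"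
      by (simp add: sum_distrib_left abs_mult)
    finally show ?thesis unfolding n(2)[symmetric] by (simp only: mult.commute)
  qed simp
  have "Pm \<noteq> []" using N by (auto simp: N_def)
  hence Ns: "real (length Pm) * 2 ^ CARD(2) * (1 / (4 * N)) = 1" by (simp add: N_def)
  have "r * (real CARD(2) / real (CARD(2) + 1) * pi +
     (1 / (4 * N))\<^sup>2 / 3 * (pi - real (length Pm) * 2 ^ CARD(2) * (1 / (4 * N)))) \<le> 4 / 3"
  proof (rule zonotope_gap[where u = b and k = 1])
    show "(\<Sum>i<length Pm. norm (b i)) \<le> 1"
      by (rule order.trans[OF sum_mono[OF norm_b] sum_norm_bloch_le[OF povm]])
    show "real (length Pm) * 2 ^ CARD(2) * (1 / (4 * N)) \<le> pi" unfolding Ns using pi by simp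
  qed (use N r h nn_integral_cball_abs_vec2 in \<open>simp_all add: unit_ball_vol_2\<close>)
  hence "r * (2 / 3 * pi + t / 48 * (pi - 1)) \<le> 4 / 3"
    unfolding Ns by (simp add: t_def power2_eq_square mult_ac)
  hence main: "2 / 3 * (r * pi) + r * (t / 48 * (pi - 1)) \<le> 4 / 3"
    by (simp add: distrib_left mult_ac)
  \<comment> \<open>As in space: for \<open>r\<close> at least \<open>1/4\<close> the gap is
    \<open>t / 192\<close>; rescaling by \<open>3/2\<close> turns it into \<open>t / 128\<close>,
    and \<open>pi < 4\<close> gives 512.\<close>
  have "(r + t / 512) * pi \<le> 2"
  proof (cases "r < 1 / 4")
    case True
    have "(r + t / 512) * pi \<le> (1 / 2) * 4"
      using True t r pi by (intro mult_mono) auto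
    thus ?thesis by simp
  next
    case False
    have "1 / 4 * (t / 48 * 1) \<le> r * (t / 48 * (pi - 1))"
      using False t pi by (intro mult_mono) auto
    hence "2 / 3 * (r * pi) + t / 192 \<le> 4 / 3" using main by linarith
    moreover have "t * pi \<le> t * 4" using t pi by (intro mult_left_mono) auto
    moreover have "(r + t / 512) * pi = r * pi + t * pi / 512" by (simp add: distrib_right)
    ultimately show ?thesis by linarith
  qed
  hence "r + t / 512 \<le> 2 / pi" using pi by (simp add: pos_le_divide_eq)
  thus ?thesis by (simp add: t_def N_def)
qed

text \<open>At radius 0 both effects are half the identity, so a fair coin simulates everything.
  Padding with zero effects gives exactly \<open>n\<close> outcomes. This makes the sets of radii
  nonempty, so that their suprema can be bounded.\<close>

lemma trivial_simulation:
  assumes "1 \<le> n" "F \<subseteq> {noisy_meas 0 v | v. True}"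
  shows "\<exists>Pm. povm Pm \<and> length Pm = n \<and> simulates Pm F"
proof -
  define Pm :: "qop list" where "Pm = mat 1 # replicate (n - 1) 0"
  have len: "length Pm = n" using assms by (simp add: Pm_def)
  have nth: "Pm ! i = (if i = 0 then mat 1 else 0)" if "i < n" for i
    using that by (cases i) (auto simp: Pm_def)
  have sum: "(\<Sum>i<n. f i *\<^sub>R (Pm ! i)) = f 0 *\<^sub>R mat 1" for f :: "nat \<Rightarrow> real"
  proof -
    have "(\<Sum>i<n. f i *\<^sub>R (Pm ! i)) = (\<Sum>i<n. if i = 0 then f 0 *\<^sub>R mat 1 else 0)"
      by (intro sum.cong) (auto simp: nth)
    thus ?thesis using assms by simp
  qed
  have psd1: "psd (mat 1 :: qop)"
    using psd_one_plus_ndotsigma[of 0] by (simp add: ndotsigma_def)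
  have "psd (Pm ! i)" if "i < n" for i
    using psd1 that psd_scaleR[OF psd1, of 0] by (simp add: nth)
  moreover have "(\<Sum>i<n. Pm ! i) = mat 1" using sum[of "\<lambda>_. 1"] by simp
  ultimately have "povm Pm" by (simp add: povm_def len)
  moreover have "simulates Pm F"
    unfolding simulates_def
  proof (intro exI ballI)
    fix M assume "M \<in> F"
    then obtain v where M: "M = noisy_meas 0 v" using assms by blast
    show "(\<forall>a<length M. M ! a = (\<Sum>i<length Pm. (1/2) *\<^sub>R (Pm ! i))) \<and>
        (\<forall>a<length M. \<forall>i<length Pm. 0 \<le> (1/2 :: real)) \<and>
        (\<forall>i<length Pm. (\<Sum>a<length M. 1/2 :: real) = 1)"
      by (auto simp: M length_noisy_meas less_2_cases_iff len sum noisy_meas_nth_0 noisy_meas_nth_1)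
  qed
  ultimately show ?thesis using len by blast
qed

lemma Rn_le:
  assumes "1 \<le> n"
  shows "Rn n \<le> 1/2 - 1/3072 / (real n)\<^sup>2"
  unfolding Rn_def
proof (rule cSup_least)
  have "\<exists>Pm. povm Pm \<and> length Pm = n \<and> simulates Pm (Pfam 0)"
    by (rule trivial_simulation[OF assms]) (auto simp: Pfam_def)
  thus "{r. 0 \<le> r \<and> (\<exists>Pm. povm Pm \<and> length Pm = n \<and> simulates Pm (Pfam r))} \<noteq> {}"
    by force
qed (use simulation_radius_bound in blast)

lemma Rpn_le:
  assumes "1 \<le> n"
  shows "Rpn n \<le> 2/pi - 1/512 / (real n)\<^sup>2"
  unfolding Rpn_def
proof (rule cSup_least)
  have "\<exists>Pm. povm Pm \<and> length Pm = n \<and> simulates Pm (Pfam_p 0)"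
    by (rule trivial_simulation[OF assms]) (auto simp: Pfam_p_def)
  thus "{r. 0 \<le> r \<and> (\<exists>Pm. povm Pm \<and> length Pm = n \<and> simulates Pm (Pfam_p r))} \<noteq> {}"
    by force
qed (use simulation_radius_bound_planar in blast)

section \<open>From local hidden states to simulating POVMs\<close>

lemma has_LHS_imp_simulates:
  assumes "has_LHS n (werner r) (Pfam 1)"
  shows "\<exists>Pm. povm Pm \<and> length Pm = n \<and> simulates Pm (Pfam r)"
proof -
  from assms obtain p \<sigma> q where
    p: "\<forall>i<n. 0 \<le> p i \<and> is_state (\<sigma> i)" and
    all: "\<forall>M\<in>Pfam 1. (\<forall>a<length M. \<forall>i<n. 0 \<le> q M a i)
        \<and> (\<forall>i<n. (\<Sum>a<length M. q M a i) = 1)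
        \<and> (\<forall>a<length M. assemb (werner r) (M!a) = (\<Sum>i<n. (q M a i * p i) *\<^sub>R \<sigma> i))"
    unfolding has_LHS_def by (elim exE conjE) (rule that)
  have q: "\<forall>a<2. \<forall>i<n. 0 \<le> q (noisy_meas 1 v) a i"
    "\<forall>i<n. (\<Sum>a<2. q (noisy_meas 1 v) a i) = 1"
    "\<forall>a<2. assemb (werner r) (noisy_meas 1 v ! a) = (\<Sum>i<n. (q (noisy_meas 1 v) a i * p i) *\<^sub>R \<sigma> i)"
    if "norm v = 1" for v
  proof -
    have "noisy_meas 1 v \<in> Pfam 1" using that by (auto simp: Pfam_def)
    from bspec[OF all this]
    show "\<forall>a<2. \<forall>i<n. 0 \<le> q (noisy_meas 1 v) a i"
      "\<forall>i<n. (\<Sum>a<2. q (noisy_meas 1 v) a i) = 1"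
      "\<forall>a<2. assemb (werner r) (noisy_meas 1 v ! a) = (\<Sum>i<n. (q (noisy_meas 1 v) a i * p i) *\<^sub>R \<sigma> i)"
      by (simp_all add: length_noisy_meas)
  qed
  \<comment> \<open>The singlet anticorrelates the two qubits, so direction \<open>v\<close> on B is steered by \<open>- v\<close> on A.\<close>
  have decomp: "noisy_meas r v ! a = (\<Sum>i<n. (q (noisy_meas 1 (- v)) a i * (2 * p i)) *\<^sub>R \<sigma> i)"
    if v: "norm v = 1" and a: "a < 2" for v a
  proof -
    have "assemb (werner r) (noisy_meas 1 (- v) ! a) = (\<Sum>i<n. (q (noisy_meas 1 (- v)) a i * p i) *\<^sub>R \<sigma> i)"
      using q(3)[of "- v"] v a by simp
    hence "(1/2) *\<^sub>R (noisy_meas r v ! a) = (\<Sum>i<n. (q (noisy_meas 1 (- v)) a i * p i) *\<^sub>R \<sigma> i)"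
      using a by (simp add: assemb_werner_noisy_meas)
    hence "2 *\<^sub>R ((1/2) *\<^sub>R (noisy_meas r v ! a)) =
        2 *\<^sub>R (\<Sum>i<n. (q (noisy_meas 1 (- v)) a i * p i) *\<^sub>R \<sigma> i)" by (rule arg_cong)
    thus ?thesis by (simp add: scaleR_sum_right mult_ac)
  qed
  \<comment> \<open>The factor 2 undoes the \<open>1/2\<close> of the steered assemblage.\<close>
  define Pm where "Pm = map (\<lambda>i. (2 * p i) *\<^sub>R \<sigma> i) [0..<n]"
  have nth: "Pm ! i = (2 * p i) *\<^sub>R \<sigma> i" if "i < n" for i
    using that by (simp add: Pm_def)
  have len: "length Pm = n" by (simp add: Pm_def)
  \<comment> \<open>Completeness comes from a single measurement, in an arbitrary direction: summed
    over its two outcomes, the responses \<open>q\<close> add to 1 and the effects to the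
    identity.\<close>
  have "(\<Sum>i<n. Pm ! i) = mat 1"
  proof -
    define v :: "real^3" where "v = axis 1 1"
    have v: "norm v = 1" by (simp add: v_def norm_axis_1)
    have "(\<Sum>i<n. Pm ! i) = (\<Sum>i<n. ((\<Sum>a<2. q (noisy_meas 1 (- v)) a i) * (2 * p i)) *\<^sub>R \<sigma> i)"
      using v q(2)[of "- v"] by (intro sum.cong) (simp_all add: nth)
    also have "\<dots> = (\<Sum>a<2. \<Sum>i<n. (q (noisy_meas 1 (- v)) a i * (2 * p i)) *\<^sub>R \<sigma> i)"
      by (subst sum.swap) (simp add: sum_distrib_right scaleR_sum_left)
    also have "\<dots> = (\<Sum>a<2. noisy_meas r v ! a)"
      using v by (intro sum.cong) (simp_all add: decomp)
    also have "\<dots> = noisy_meas r v ! 0 + noisy_meas r v ! Suc 0"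
      by (simp add: numeral_2_eq_2)
    also have "\<dots> = mat 1"
      by (simp add: noisy_meas_nth_0 noisy_meas_nth_1 scaleR_add_right scaleR_diff_right
          flip: scaleR_add_left)
    finally show ?thesis .
  qed
  moreover have "psd (Pm ! i)" if "i < n" for i
    using p that by (simp add: nth psd_scaleR is_state_def)
  ultimately have "povm Pm" by (simp add: povm_def len)
  moreover have "simulates Pm (Pfam r)"
  proof -
    \<comment> \<open>For \<open>r = 0\<close> all directions give the same measurement, hence the choice.\<close>
    define dir where "dir M = (SOME v. norm v = 1 \<and> M = noisy_meas r v)" for M
    show ?thesis unfolding simulates_def
    proof (rule exI[of _ "\<lambda>M. q (noisy_meas 1 (- dir M))"], rule ballI)
      fix M assume "M \<in> Pfam r"
      hence "\<exists>v. norm v = 1 \<and> M = noisy_meas r v" by (auto simp: Pfam_def)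
      hence "norm (dir M) = 1 \<and> M = noisy_meas r (dir M)"
        unfolding dir_def by (rule someI_ex)
      hence d: "norm (dir M) = 1" "M = noisy_meas r (dir M)" by blast+
      have "length M = 2" by (subst d(2)) (rule length_noisy_meas)
      moreover have "M ! a = (\<Sum>i<n. q (noisy_meas 1 (- dir M)) a i *\<^sub>R (Pm ! i))" if "a < 2" for a
      proof -
        have "M ! a = noisy_meas r (dir M) ! a" using d(2) by (rule arg_cong)
        also have "\<dots> = (\<Sum>i<n. q (noisy_meas 1 (- dir M)) a i *\<^sub>R (Pm ! i))"
          unfolding decomp[OF d(1) that] by (intro sum.cong) (simp_all add: nth)
        finally show ?thesis .
      qed
      ultimately show "(\<forall>a<length M. M ! a = (\<Sum>i<length Pm. q (noisy_meas 1 (- dir M)) a i *\<^sub>R (Pm ! i))) \<and>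
         (\<forall>a<length M. \<forall>i<length Pm. 0 \<le> q (noisy_meas 1 (- dir M)) a i) \<and>
         (\<forall>i<length Pm. (\<Sum>a<length M. q (noisy_meas 1 (- dir M)) a i) = 1)"
        using q(1,2)[of "- dir M"] d(1) by (simp add: len)
    qed
  qed
  ultimately show ?thesis using len by blast
qed

text \<open>Projective measurements are among the POVMs covered by \<open>gamma\<close>, so every
  size admissible there is admissible for \<open>Nr\<close>, and the infimum of the larger set is
  smaller.\<close>

lemma Nr_le_gamma_werner: "Nr r \<le> gamma (werner r)"
  unfolding Nr_def gamma_def
proof (rule Inf_superset_mono, clarify)
  fix n
  assume F: "\<forall>F. (\<forall>M\<in>F. povm M) \<longrightarrow> has_LHS n (werner r) F"
  have "\<forall>M\<in>Pfam 1. povm M" by (auto simp: Pfam_def intro: povm_noisy_meas_1)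
  with F have "has_LHS n (werner r) (Pfam 1)" by blast
  thus "\<exists>n'. enat n = enat n' \<and> (\<exists>Pm. povm Pm \<and> length Pm = n' \<and> simulates Pm (Pfam r))"
    using has_LHS_imp_simulates by blast
qed

text \<open>A finite value excludes the empty set, and a nonempty set of extended naturals attains
  its infimum.\<close>

lemma Nr_eq_enat_imp:
  assumes "Nr r = enat m"
  shows "\<exists>Pm. povm Pm \<and> length Pm = m \<and> simulates Pm (Pfam r)"
proof -
  let ?S = "{enat n | n. \<exists>Pm. povm Pm \<and> length Pm = n \<and> simulates Pm (Pfam r)}"
  have "?S \<noteq> {}"
  proof
    assume "?S = {}"
    hence "Nr r = \<infinity>" unfolding Nr_def by (simp only: Inf_empty top_enat_def)
    thus False using assms by simp
  qed
  then obtain k where "k \<in> ?S" unfolding ex_in_conv[symmetric] by (rule exE)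
  hence "Inf ?S \<in> ?S" by (rule wellorder_InfI)
  hence "enat m \<in> ?S" using assms unfolding Nr_def by (rule back_subst)
  thus ?thesis by simp
qed

text \<open>Relaxes the deficit of order \<open>n\<^sup>-\<^sup>2\<close> to the claimed rates with
  exponents \<open>-5/2\<close> and \<open>-4\<close>.\<close>

lemma inverse_square_ge_powr:
  assumes "1 \<le> n" "a \<le> -2"
  shows "real n powr a \<le> 1 / (real n)\<^sup>2"
proof -
  have "real n powr a \<le> real n powr (-2)" using assms by (intro powr_mono) auto
  also have "\<dots> = 1 / (real n)\<^sup>2" using assms by (simp add: powr_minus_divide)
  finally show ?thesis .
qed

theorem theorem1:
  shows "(\<exists>c3 c2 :: real. c3 > 0 \<and> c2 > 0 \<and>
            (\<forall>n::nat. n \<ge> 1 \<longrightarrow>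
               Rn n \<le> 1/2 - c3 * real n powr (-5/2) \<and>
               Rpn n \<le> 2/pi - c2 * real n powr (-4)))
       \<and> (\<exists>c :: real. c > 0 \<and>
            (\<forall>r :: real. 0 \<le> r \<and> r < 1/2 \<longrightarrow>
               Nr r \<le> gamma (werner r) \<and>
               (\<forall>m::nat. Nr r = enat m \<longrightarrow> real m > c * (1/2 - r) powr (-2/5))))"
proof (intro conjI)
  have "Rn n \<le> 1/2 - 1/3072 * real n powr (-5/2) \<and> Rpn n \<le> 2/pi - 1/512 * real n powr (-4)"
    if "1 \<le> n" for n
    using Rn_le[OF that] Rpn_le[OF that] inverse_square_ge_powr[OF that, of "-5/2"]
      inverse_square_ge_powr[OF that, of "-4"] by simp
  thus "\<exists>c3 c2 :: real. c3 > 0 \<and> c2 > 0 \<and>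
            (\<forall>n::nat. n \<ge> 1 \<longrightarrow>
               Rn n \<le> 1/2 - c3 * real n powr (-5/2) \<and>
               Rpn n \<le> 2/pi - c2 * real n powr (-4))"
    by (intro exI[of _ "1/3072"] exI[of _ "1/512"]) simp
next
  \<comment> \<open>Solving \<open>1/3072 * real m powr (-5/2) \<le> \<delta>\<close> for
    \<open>m\<close> gives \<open>C * \<delta> powr (-2/5) \<le> real m\<close>. Halving
    \<open>C\<close> makes the inequality strict.\<close>
  define C :: real where "C = (1/3072) powr (2/5)"
  have C: "0 < C" by (simp add: C_def)
  have "C / 2 * (1/2 - r) powr (-2/5) < real m" if r: "0 \<le> r" "r < 1/2" and m: "Nr r = enat m" for r m
  proof -
    define \<delta> where "\<delta> = 1/2 - r"
    have \<delta>: "0 < \<delta>" using r by (simp add: \<delta>_def)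
    obtain Pm where Pm: "povm Pm" "length Pm = m" "simulates Pm (Pfam r)"
      using Nr_eq_enat_imp[OF m] by blast
    have m1: "1 \<le> m" using povm_length_pos[OF Pm(1)] Pm(2) by simp
    have "1/3072 * real m powr (-5/2) \<le> \<delta>"
      using simulation_radius_bound[OF Pm(1,3) r(1)] inverse_square_ge_powr[OF m1, of "-5/2"] Pm(2)
      by (simp add: \<delta>_def)
    \<comment> \<open>The negative exponent reverses the inequality.\<close>
    hence "\<delta> powr (-2/5) \<le> (1/3072 * real m powr (-5/2)) powr (-2/5)"
      using m1 \<delta> by (intro powr_mono2') auto
    also have "\<dots> = real m / C"
      using m1 by (simp add: powr_mult powr_powr C_def powr_minus_divide powr_divide)
    finally have "C * \<delta> powr (-2/5) \<le> real m" using C by (simp add: pos_le_divide_eq mult.commute)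
    moreover have "0 < C * \<delta> powr (-2/5)" using C \<delta> by simp
    ultimately show ?thesis unfolding \<delta>_def[symmetric] by simp
  qed
  thus "\<exists>c :: real. c > 0 \<and>
            (\<forall>r :: real. 0 \<le> r \<and> r < 1/2 \<longrightarrow>
               Nr r \<le> gamma (werner r) \<and>
               (\<forall>m::nat. Nr r = enat m \<longrightarrow> real m > c * (1/2 - r) powr (-2/5)))"
    using C Nr_le_gamma_werner by (intro exI[of _ "C / 2"]) auto
qed

end
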